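(* Let $n\ge2$, $1\le d\le n-1$ and $c=n-d$. The structure constants $\langle s_\lambda,s_\mu,s_\nu\rangle_k$ for multiplication in the basis $\{q^ks_\lambda : \lambda\in\mathrm{Sh}(d,c),\ k\in\mathbb Z_{\ge0}\}$ of $\Lambda_{d,n}$, defined for $\lambda,\mu\in\mathrm{Sh}(d,c)$ by $$s_\lambda s_\mu=\sum_{k\in\mathbb Z_{\ge 0},\ \nu\in\mathrm{Sh}(d,c)}\langle s_\lambda,s_\mu,s_\nu\rangle_k\,q^k s_{\mathrm{PD}(\nu)},$$ are computed by $$\langle s_\lambda,s_\mu,s_\nu\rangle_k=\frac1{n^d}\sum_{J\in\mathcal I_{d,n}}S_\lambda(\zeta^J)S_\mu(\zeta^J)S_\nu(\zeta^J)\frac{|\mathrm{Vand}(\zeta^J)|^2}{S_{(c^d)}(\zeta^J)}$$ whenever $cd+kn=|\lambda|+|\mu|+|\nu|$, and otherwise by $\langle s_\lambda,s_\mu,s_\nu\rangle_k=0$.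
   Context: The ring: for $k=1,\dots,n$ let $Y_k=\det(X_{i-j+1})_{i,j=1,\dots,k}\in\mathbb Z[X_1,\dots,X_d]$ with $X_0:=1$ and $X_k:=0$ if $k\notin\{0,\dots,d\}$. $\Lambda_{d,n}:=\mathbb C[X_1,\dots,X_d]/(Y_{c+1},\dots,Y_{n-1})$, and $q:=(-1)^{d+1}Y_n\in\Lambda_{d,n}$. Partitions: $\mathrm{Sh}(d,c)$ is the set of partitions $\lambda=(\lambda_1\ge\dots\ge\lambda_d\ge0)$ with $\lambda_1\le c$; $|\lambda|=\sum_i\lambda_i$; $\lambda^t=(\lambda^t_1,\dots,\lambda^t_c)$ is the conjugate partition; $\mathrm{PD}(\lambda)=(c-\lambda_d,\dots,c-\lambda_1)$; $(c^d)=(c,\dots,c)$. In $\Lambda_{d,n}$ put $s_\lambda=\det(X_{\lambda^t_i+j-i})_{i,j=1,\dots,c}$. The elements $q^ks_\lambda$ ($k\ge0$, $\lambda\in\mathrm{Sh}(d,c)$) form a basis of $\Lambda_{d,n}$. $S_\lambda$ denotes the Schur polynomial in $d$ variables, $S_\lambda=\det(H_{\lambda_i+j-i})_{i,j=1,\dots,d}$, with $H_k$ the complete homogeneous symmetric polynomial in $d$ variables ($H_0=1$, $H_k=0$ for $k<0$). Roots of unity: $\zeta=\exp(2\pi\sqrt{-1}/n)$ and $\zeta^a:=\exp(2\pi\sqrt{-1}\,a/n)$ for $a\in\frac12\mathbb Z$. $\mathcal I_{d,n}$ is the set of $d$-tuples $J=(j_1,\dots,j_d)$ with $-\frac{d-1}2\le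 j_1<\dots<j_d\le n-\frac{d+1}2$, where all $j_k$ are integers if $d$ is odd and all $j_k\in\frac12+\mathbb Z$ if $d$ is even. $\zeta^J=(\zeta^{j_1},\dots,\zeta^{j_d})$, and $|\mathrm{Vand}(\zeta^J)|=\prod_{k<l}|\zeta^{j_k}-\zeta^{j_l}|$. *)

theory Defs
  imports
    Complex_Main
    "HOL-Library.Poly_Mapping"
    "HOL-Algebra.QuotRing"
    "HOL-Algebra.Algebraic_Closure_Type"
    "Jordan_Normal_Form.Determinant"
begin

section \<open>The ring \<open>\<Lambda>\<^bsub>d,n\<^esub>\<close>\<close>

text \<open>A polynomial is a finitely supported map from monomials (finitely supported exponent
  functions) to coefficients; the instances of \<open>poly_mapping\<close> supply the ring structure.\<close>

type_synonym cpoly = "(nat \<Rightarrow>\<^sub>0 nat) \<Rightarrow>\<^sub>0 complex"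

definition cpoly_ring :: "nat \<Rightarrow> cpoly ring" where
  "cpoly_ring d = ring_of_type_algebra
     \<lparr>carrier := {p. \<forall>m\<in>Poly_Mapping.keys p. Poly_Mapping.keys m \<subseteq> {1..d}}\<rparr>"

definition X_poly :: "nat \<Rightarrow> int \<Rightarrow> cpoly" where
  "X_poly d k =
     (if k = 0 then 1
      else if 1 \<le> k \<and> k \<le> int d
        then Poly_Mapping.single (Poly_Mapping.single (nat k) 1) 1
      else 0)"

text \<open>Matrix indices of \<open>mat\<close> start at 0. This leaves the differences of row and column
  indices unchanged.\<close>

definition Y_poly :: "nat \<Rightarrow> nat \<Rightarrow> cpoly" where
  "Y_poly d k = det (mat k k (\<lambda>(i, j). X_poly d (int i - int j + 1)))"

definition Lambda_ideal :: "nat \<Rightarrow> nat \<Rightarrow> cpoly set" where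
  "Lambda_ideal d n = Idl\<^bsub>cpoly_ring d\<^esub> (Y_poly d ` {n - d + 1..n - 1})"

definition Lambda_ring :: "nat \<Rightarrow> nat \<Rightarrow> cpoly set ring" where
  "Lambda_ring d n = cpoly_ring d Quot Lambda_ideal d n"

definition Lambda_class :: "nat \<Rightarrow> nat \<Rightarrow> cpoly \<Rightarrow> cpoly set" where
  "Lambda_class d n p = Lambda_ideal d n +>\<^bsub>cpoly_ring d\<^esub> p"

definition Lambda_const :: "nat \<Rightarrow> nat \<Rightarrow> complex \<Rightarrow> cpoly set" where
  "Lambda_const d n z = Lambda_class d n (Poly_Mapping.single 0 z)"

definition q_elem :: "nat \<Rightarrow> nat \<Rightarrow> cpoly set" where
  "q_elem d n = Lambda_class d n ((- 1) ^ (d + 1) * Y_poly d n)"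


section \<open>Partitions and Schur elements\<close>

definition Sh :: "nat \<Rightarrow> nat \<Rightarrow> nat list set" where
  "Sh d c = {la. length la = d \<and> sorted_wrt (\<ge>) la \<and> set la \<subseteq> {0..c}}"

definition conj_part :: "nat \<Rightarrow> nat list \<Rightarrow> nat list" where
  "conj_part c la = map (\<lambda>j. card {i. i < length la \<and> j \<le> la ! i}) [1..<c + 1]"

definition PD :: "nat \<Rightarrow> nat list \<Rightarrow> nat list" where
  "PD c la = rev (map (\<lambda>x. c - x) la)"

definition s_elem :: "nat \<Rightarrow> nat \<Rightarrow> nat list \<Rightarrow> cpoly set" where
  "s_elem d n la = Lambda_class d n
     (det (mat (n - d) (n - d)
       (\<lambda>(i, j). X_poly d (int (conj_part (n - d) la ! i) + int j - int i))))"


section \<open>Structure constants\<close>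

text \<open>\<open>N k \<nu>\<close> is the coefficient of \<open>q\<^sup>k s\<^bsub>PD(\<nu>)\<^esub>\<close>, not of \<open>q\<^sup>k s\<^bsub>\<nu>\<^esub>\<close>.
  Uniqueness of the family requires it to vanish when \<open>\<nu>\<close> is not in \<open>Sh d (n - d)\<close>.\<close>

definition is_expansion ::
  "nat \<Rightarrow> nat \<Rightarrow> cpoly set \<Rightarrow> (nat \<Rightarrow> nat list \<Rightarrow> complex) \<Rightarrow> bool" where
  "is_expansion d n a N \<longleftrightarrow>
     finite {(k, nu). N k nu \<noteq> 0} \<and>
     (\<forall>k nu. nu \<notin> Sh d (n - d) \<longrightarrow> N k nu = 0) \<and>
     a = finsum (Lambda_ring d n)
           (\<lambda>(k, nu). Lambda_const d n (N k nu) \<otimes>\<^bsub>Lambda_ring d n\<^esub>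
              (q_elem d n [^]\<^bsub>Lambda_ring d n\<^esub> k \<otimes>\<^bsub>Lambda_ring d n\<^esub>
               s_elem d n (PD (n - d) nu)))
           {(k, nu). N k nu \<noteq> 0}"

definition struct_const ::
  "nat \<Rightarrow> nat \<Rightarrow> nat list \<Rightarrow> nat list \<Rightarrow> nat list \<Rightarrow> nat \<Rightarrow> complex" where
  "struct_const d n la mu nu k =
     (THE N. is_expansion d n (s_elem d n la \<otimes>\<^bsub>Lambda_ring d n\<^esub> s_elem d n mu) N) k nu"


section \<open>Schur polynomials at roots of unity\<close>

text \<open>Symmetric polynomials in \<open>d\<close> variables are given by their values on lists of length
  \<open>d\<close>. In \<open>complete_hom\<close> the list \<open>m\<close> runs over the exponent vectors of the monomials of
  degree \<open>k\<close>.\<close>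

definition complete_hom :: "'a::comm_ring_1 list \<Rightarrow> int \<Rightarrow> 'a" where
  "complete_hom xs k =
     (if k < 0 then 0
      else \<Sum>m\<in>{m. length m = length xs \<and> sum_list m = nat k}.
             \<Prod>i<length xs. xs ! i ^ (m ! i))"

definition schur :: "nat list \<Rightarrow> 'a::comm_ring_1 list \<Rightarrow> 'a" where
  "schur la xs =
     det (mat (length xs) (length xs)
       (\<lambda>(i, j). complete_hom xs (int (la ! i) + int j - int i)))"

definition root_index :: "nat \<Rightarrow> nat \<Rightarrow> real list set" where
  "root_index d n =
     {J. length J = d \<and> sorted_wrt (<) J \<and>
         (\<forall>j\<in>set J. - (real d - 1) / 2 \<le> j \<and> j \<le> real n - (real d + 1) / 2) \<and>
         (if odd d then set J \<subseteq> \<int> else \<forall>j\<in>set J. j - 1 / 2 \<in> \<int>)}"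

definition zeta_pow :: "nat \<Rightarrow> real \<Rightarrow> complex" where
  "zeta_pow n a = exp (2 * of_real pi * \<i> * of_real a / of_nat n)"

definition zeta_tuple :: "nat \<Rightarrow> real list \<Rightarrow> complex list" where
  "zeta_tuple n J = map (zeta_pow n) J"

definition abs_vand :: "complex list \<Rightarrow> real" where
  "abs_vand xs = (\<Prod>l<length xs. \<Prod>k<l. cmod (xs ! k - xs ! l))"

end

theory Submission
  imports Defs "HOL-Computational_Algebra.Formal_Power_Series"
begin

text \<open>
  Identify \<open>X\<^sub>i\<close> with the elementary symmetric polynomial \<open>e\<^sub>i\<close>, so that \<open>Y\<^sub>k\<close> becomes the complete
  homogeneous polynomial \<open>h\<^sub>k\<close> and \<open>s\<^sub>\<lambda>\<close> becomes \<open>det (h\<^bsub>\<lambda>\<^sub>i + j - i\<^esub>)\<close>.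

  Existence of the expansion: in \<open>\<Lambda>\<close> the recurrence of \<open>h\<close> gives \<open>h\<^bsub>n + m\<^esub> = h\<^sub>n h\<^sub>m\<close> for
  \<open>m > - d\<close>, so every determinant \<open>det (h\<^bsub>b\<^sub>i - d + j\<^esub>)\<close>, \<open>b\<^sub>i \<ge> 0\<close>, can be reduced modulo \<open>n\<close> in
  each row and sorted; it equals \<open>0\<close> or \<open>\<plusminus> q\<^sup>k s\<^sub>\<nu>\<close> with \<open>\<nu> \<in> Sh d c\<close>. By the Pieri rule these
  determinants span an ideal.

  Uniqueness and the formula: the tuples \<open>t \<zeta>\<^sup>J\<close>, \<open>t \<noteq> 0\<close>, are zeros of \<open>h\<^bsub>c + 1\<^esub>, \<dots>, h\<^bsub>n - 1\<^esub>\<close>, and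
  evaluation there sends \<open>q\<^sup>k s\<^sub>\<nu>\<close> to \<open>t\<^bsup>k n + |\<nu>|\<^esup> S\<^sub>\<nu> (\<zeta>\<^sup>J)\<close>. By the Cauchy--Binet formula the alternants
  \<open>S\<^sub>\<nu> (\<zeta>\<^sup>J) Vand (\<zeta>\<^sup>J)\<close> are orthogonal as functions of \<open>J\<close>, so pairing with one of them and
  comparing coefficients of powers of \<open>t\<close> determines each structure constant.
\<close>

subsection \<open>Determinants and the dual Jacobi--Trudi identity\<close>

text \<open>The scale t is needed because q takes the value 1 at every zeta^J, so these tuples alone
  cannot tell the exponents k apart. The sign in q and the half-integer indices for even d belong
  together: each coordinate of zeta^J satisfies x^n = (-1)^(d+1), hence h_n = (-1)^(d+1) there, and
  the two signs cancel. The factor |Vand|^2 / S_(c^d) is what a complex conjugate leaves behind: the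
  pairing uses the conjugate of the alternant of PD(nu), and on the unit circle the conjugate of
  S_(PD nu) is S_nu / S_(c^d). The coefficient formula is derived for an arbitrary expansion, so it
  also gives the uniqueness on which the definite description in \<open>struct_const\<close>
  depends. Relations between e and h are proved for an abstract pair of sequences, because they are
  needed twice: for the variables X_i with \<open>h_poly\<close>, and for the symmetric functions of
  a tuple of numbers.\<close>

lemma det_vandermonde:
  fixes x :: "nat \<Rightarrow> 'a::idom"
  shows "det (mat n n (\<lambda>(i, j). x i ^ j)) = (\<Prod>j<n. \<Prod>i<j. x j - x i)"
proof -
  \<comment> \<open>Newton basis: \<open>p j\<close> is monic of degree j and vanishes at the points
    before x j. Changing to it multiplies by a unitriangular matrix and leaves a triangular
    one.\<close>
  define p where "p j = (\<Prod>l<j. [:- x l, 1:])" for j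
  have p_deg: "degree (p j) = j" for j
    unfolding p_def by (subst degree_prod_eq_sum_degree) auto
  have p_lead: "coeff (p j) j = 1" for j
    using lead_coeff_prod[of "\<lambda>l. [:- x l, 1:]" "{..<j}"] p_deg[of j] by (simp add: p_def)
  have p_eval: "poly (p j) y = (\<Prod>l<j. y - x l)" for j y
    by (simp add: p_def poly_prod)
  let ?V = "mat n n (\<lambda>(i, j). x i ^ j)"
  let ?U = "mat n n (\<lambda>(k, j). coeff (p j) k)"
  let ?P = "mat n n (\<lambda>(i, j). poly (p j) (x i))"
  have VU: "?V * ?U = ?P"
  proof (rule eq_matI)
    fix i j assume ij: "i < dim_row ?P" "j < dim_col ?P"
    have "(\<Sum>k\<in>{0..<n}. x i ^ k * coeff (p j) k) = (\<Sum>k\<le>degree (p j). coeff (p j) k * x i ^ k)"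
      using ij by (intro sum.mono_neutral_cong_right) (auto simp: p_deg coeff_eq_0 mult.commute)
    then show "(?V * ?U) $$ (i, j) = ?P $$ (i, j)"
      using ij by (simp add: scalar_prod_def poly_altdef)
  qed auto
  have "det ?U = prod_list (diag_mat ?U)"
    by (rule det_upper_triangular) (auto simp: upper_triangular_def coeff_eq_0 p_deg)
  also have "\<dots> = 1"
    by (simp add: diag_mat_def p_lead prod.list_conv_set_nth)
  finally have U: "det ?U = 1" .
  have P0: "poly (p j) (x i) = 0" if "i < j" for i j
    using that by (auto simp: p_eval intro!: prod_zero)
  have "det ?P = prod_list (diag_mat ?P)"
    by (rule det_lower_triangular[where n = n]) (auto simp: P0)
  also have "\<dots> = (\<Prod>j<n. \<Prod>i<j. x j - x i)"
    by (simp add: diag_mat_def p_eval prod.list_conv_set_nth atLeast0LessThan)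
  finally have P: "det ?P = (\<Prod>j<n. \<Prod>i<j. x j - x i)" .
  have "det (?V * ?U) = det ?V * det ?U"
    by (rule det_mult[where n = n]) auto
  with VU U P show ?thesis by simp
qed

lemma sgn_prod_int: "sgn (\<Prod>i\<in>A. f i) = (\<Prod>i\<in>A. sgn (f i :: int))"
  by (induction A rule: infinite_finite_induct) (auto simp: sgn_mult)

text \<open>Permuting the rows of the Vandermonde matrix of 0, ..., n - 1 multiplies its positive
  determinant by the sign. The product counts inversions pair by pair, so two permutations can be
  compared locally.\<close>

lemma sign_eq_prod_sgn:
  assumes "p permutes {0..<n}"
  shows "sign p = (\<Prod>j<n. \<Prod>i<j. sgn (int (p j) - int (p i)))"
proof -
  have "det (mat n n (\<lambda>(i, j). (mat n n (\<lambda>(i, j). int i ^ j)) $$ (p i, j)))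
        = of_int (sign p) * det (mat n n (\<lambda>(i, j). int i ^ j))"
    by (rule det_permute_rows) (use assms in auto)
  moreover have "mat n n (\<lambda>(i, j). (mat n n (\<lambda>(i, j). int i ^ j)) $$ (p i, j))
                 = mat n n (\<lambda>(i, j). int (p i) ^ j)"
    using permutes_in_image[OF assms] by (intro eq_matI) auto
  ultimately have eq: "(\<Prod>j<n. \<Prod>i<j. int (p j) - int (p i)) = sign p * (\<Prod>j<n. \<Prod>i<j. int j - int i)"
    by (simp add: det_vandermonde[of n "\<lambda>i. int (p i)"] det_vandermonde)
  have "(\<Prod>j<n. \<Prod>i<j. int j - int i) > 0"
    by (intro prod_pos) auto
  then have "sgn (sign p * (\<Prod>j<n. \<Prod>i<j. int j - int i)) = sign p"
    by (simp add: sgn_mult sign_def)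
  then show ?thesis
    unfolding eq[symmetric] by (simp add: sgn_prod_int)
qed

lemma det_scale_rows_cols:
  "det (mat n n (\<lambda>(i, j). r i * s j * f i j)) =
     (\<Prod>i<n. r i) * (\<Prod>j<n. s j) * det (mat n n (\<lambda>(i, j). f i j :: 'a::comm_ring_1))"
proof -
  have "(\<Prod>i = 0..<n. r i * s (p i) * f i (p i)) =
        (\<Prod>i<n. r i) * (\<Prod>j<n. s j) * (\<Prod>i = 0..<n. f i (p i))" if "p permutes {0..<n}" for p
    using prod.permute[OF that, of s] by (simp add: prod.distrib o_def atLeast0LessThan)
  then show ?thesis
    by (subst (1 2) det_def'[of _ n])
       (auto simp: sum_distrib_left mult_ac intro!: sum.cong)
qed

lemma det_mat_transpose:
  "det (mat n n (\<lambda>(i, j). f j i)) = det (mat n n (\<lambda>(i, j). f i j :: 'a::comm_ring_1))"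
proof -
  have "transpose_mat (mat n n (\<lambda>(i, j). f i j)) = mat n n (\<lambda>(i, j). f j i)"
    by (rule eq_matI) auto
  then show ?thesis
    using det_transpose[of "mat n n (\<lambda>(i, j). f i j)" n] by simp
qed

lemma det_permute_cols:
  assumes "p permutes {0..<n}"
  shows "det (mat n n (\<lambda>(i, j). f i (p j))) = of_int (sign p) * det (mat n n (\<lambda>(i, j). f i j :: 'a::comm_ring_1))"
proof -
  let ?A = "mat n n (\<lambda>(i, j). f j i)"
  have "det (mat n n (\<lambda>(i, j). f i (p j))) = det (mat n n (\<lambda>(i, j). ?A $$ (p i, j)))"
  proof -
    have "mat n n (\<lambda>(i, j). ?A $$ (p i, j)) = mat n n (\<lambda>(i, j). f j (p i))"
      using permutes_in_image[OF assms] by (intro eq_matI) auto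
    then show ?thesis
      using det_mat_transpose[of n "\<lambda>i j. f i (p j)"] by simp
  qed
  also have "\<dots> = of_int (sign p) * det ?A"
    by (rule det_permute_rows) (use assms in auto)
  also have "det ?A = det (mat n n (\<lambda>(i, j). f i j))"
    by (rule det_mat_transpose)
  finally show ?thesis .
qed

text \<open>For the generating series the recurrence is E(-t) H(t) = 1.\<close>

locale eh_pair =
  fixes e h :: "int \<Rightarrow> 'a::idom"
  assumes e_neg: "k < 0 \<Longrightarrow> e k = 0" and h_neg: "k < 0 \<Longrightarrow> h k = 0"
    and e_0: "e 0 = 1" and h_0: "h 0 = 1"
    and recurrence: "m > 0 \<Longrightarrow> (\<Sum>i\<le>m. (-1) ^ i * e (int i) * h (int m - int i)) = 0"
begin

text \<open>The Toeplitz matrices of H(t) and E(-t) are lower triangular, so cutting them to size n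
  keeps them inverse to each other.\<close>

lemma toeplitz_inverse:
  assumes "a < n" "b < n"
  shows "(\<Sum>k<n. h (int a - int k) * ((-1) ^ (k + b) * e (int k - int b))) = (if a = b then 1 else 0)"
proof (cases "a < b")
  case True
  then have "h (int a - int k) * ((-1) ^ (k + b) * e (int k - int b)) = 0" for k
    by (cases "k < b") (auto simp: e_neg h_neg)
  with True show ?thesis by (auto intro!: sum.neutral)
next
  case False
  have "(\<Sum>k<n. h (int a - int k) * ((-1) ^ (k + b) * e (int k - int b)))
        = (\<Sum>k\<in>{b..a}. h (int a - int k) * ((-1) ^ (k + b) * e (int k - int b)))"
    using assms by (intro sum.mono_neutral_right) (auto simp: e_neg h_neg not_le)
  also have "\<dots> = (\<Sum>i\<le>a - b. (-1) ^ i * e (int i) * h (int (a - b) - int i))"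
  proof (rule sum.reindex_bij_witness[of _ "\<lambda>i. i + b" "\<lambda>k. k - b"])
    fix k assume k: "k \<in> {b..a}"
    then have "(- 1 :: 'a) ^ (k + b) = (- 1) ^ (k - b)"
      by (auto simp: minus_one_power_iff)
    with k False show "(- 1) ^ (k - b) * e (int (k - b)) * h (int (a - b) - int (k - b)) =
                 h (int a - int k) * ((- 1) ^ (k + b) * e (int k - int b))"
      by (simp add: of_nat_diff)
  qed (use False in auto)
  also have "\<dots> = (if a = b then 1 else 0)"
    using False recurrence[of "a - b"] by (auto simp: e_0 h_0)
  finally show ?thesis .
qed

text \<open>The proof applies Jacobi's theorem on complementary minors to the Toeplitz matrix of \<open>h\<close>
  and its inverse. The rows \<open>\<rho>\<close> list the numbers \<open>\<lambda>\<^sub>i + d - 1 - i\<close> and then their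
  complement in \<open>{0..<d + c}\<close>; the columns \<open>\<kappa>\<close> are the case \<open>\<lambda> = 0\<close> of \<open>\<rho>\<close>.\<close>

lemma dual_jacobi_trudi:
  assumes la: "la \<in> Sh d c"
  shows "det (mat d d (\<lambda>(i, j). h (int (la ! i) + int j - int i))) =
         det (mat c c (\<lambda>(i, j). e (int (conj_part c la ! i) + int j - int i)))"
proof -
  define n where "n = d + c"
  define la' where "la' j = conj_part c la ! j" for j
  have len: "length la = d" and dec: "\<And>i j. i < j \<Longrightarrow> j < d \<Longrightarrow> la ! j \<le> la ! i"
    and le_c: "\<And>i. i < d \<Longrightarrow> la ! i \<le> c"
    using la by (auto simp: Sh_def sorted_wrt_iff_nth_less subset_iff in_set_conv_nth)
  have dec_le: "la ! j \<le> la ! i" if "i \<le> j" "j < d" for i j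
    using dec[of i j] that by (cases "i = j") auto
  \<comment> \<open>Both sides say that cell (i, j) lies in the diagram: the rows longer than j form
    an initial segment of \<open>la' j\<close> rows.\<close>
  have cell_iff: "i < la' j \<longleftrightarrow> j < la ! i" if "i < d" "j < c" for i j
  proof -
    have la'_eq: "la' j = card {i. i < d \<and> j < la ! i}"
      using that by (simp add: la'_def conj_part_def len Suc_le_eq del: upt_Suc)
    show ?thesis
    proof
      assume "j < la ! i"
      then have "{..i} \<subseteq> {i. i < d \<and> j < la ! i}"
        using that by (auto intro: less_le_trans dec_le)
      from card_mono[OF _ this] show "i < la' j"
        by (simp add: la'_eq)
    next
      assume *: "i < la' j"
      show "j < la ! i"
      proof (rule ccontr)
        assume "\<not> j < la ! i"
        then have "{i. i < d \<and> j < la ! i} \<subseteq> {..<i}"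
          using dec_le[of i] by (auto simp flip: not_le) (meson dec_le le_trans not_less)
        from card_mono[OF _ this] show False
          using * by (simp add: la'_eq)
      qed
    qed
  qed
  have la'_le: "la' j \<le> d" if "j < c" for j
  proof -
    have "{i. i < d \<and> j < la ! i} \<subseteq> {..<d}" by auto
    from card_mono[OF _ this] show ?thesis
      using that by (simp add: la'_def conj_part_def len Suc_le_eq del: upt_Suc)
  qed
  have la'_dec: "la' k \<le> la' j" if "j < k" "k < c" for j k
  proof (rule ccontr)
    assume "\<not> la' k \<le> la' j"
    moreover from this have "la' j < d"
      using la'_le[of k] that by linarith
    ultimately show False
      using cell_iff[of "la' j" k] cell_iff[of "la' j" j] that by auto
  qed
  define be where "be i = la ! i + (d - 1 - i)" for i
  define ga where "ga j = d + j - la' j" for j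
  have be_dec: "be j < be i" if "i < j" "j < d" for i j
    using dec[OF that] that by (simp add: be_def)
  have ga_inc: "ga j < ga k" if "j < k" "k < c" for j k
    using la'_dec[OF that] la'_le[of j] la'_le[of k] that by (simp add: ga_def)
  have be_ga: "if i < la' j then ga j < be i else be i < ga j" if "i < d" "j < c" for i j
    using cell_iff[OF that] la'_le[of j] that by (auto simp: be_def ga_def)
  define rho where "rho i = (if i < d then be i else if i < n then ga (i - d) else i)" for i
  define kap where "kap i = (if i < d then d - 1 - i else i)" for i
  have rho_less: "rho i < n" if "i < n" for i
    using that le_c[of i] by (auto simp: rho_def be_def ga_def n_def)
  have "inj_on rho {0..<n}"
  proof (rule linorder_inj_onI)
    fix i j assume ij: "i < j" "i \<in> {0..<n}" "j \<in> {0..<n}"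
    then consider "j < d" | "i < d" "d \<le> j" | "d \<le> i"
      by linarith
    then show "rho i \<noteq> rho j"
    proof cases
      case 1 then show ?thesis using be_dec[of i j] ij by (auto simp: rho_def)
    next
      case 2
      then have "j - d < c" using ij by (auto simp: n_def)
      with 2 ij be_ga[of i "j - d"] show ?thesis
        by (auto simp: rho_def n_def split: if_splits)
    next
      case 3
      then have "i - d < j - d" "j - d < c" using ij by (auto simp: n_def)
      with 3 ij ga_inc[of "i - d" "j - d"] show ?thesis
        by (auto simp: rho_def n_def)
    qed
  qed auto
  moreover from this have "rho ` {0..<n} = {0..<n}"
    using rho_less by (intro endo_inj_surj) auto
  ultimately have "bij_betw rho {0..<n} {0..<n}"
    by (rule bij_betw_imageI)
  then have rho: "rho permutes {0..<n}"
    by (rule bij_imp_permutes) (auto simp: rho_def n_def)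
  have kap: "kap permutes {0..<n}"
  proof (rule bij_imp_permutes)
    show "bij_betw kap {0..<n} {0..<n}"
      by (rule bij_betwI[of _ _ _ kap]) (auto simp: kap_def n_def)
  qed (auto simp: kap_def n_def)
  \<comment> \<open>Both permutations decrease on the first d places and increase on the last c.
    They order a mixed pair differently exactly when it is a cell of the diagram, so the sign counts
    cells.\<close>
  have sign_rho_kap: "sign rho * sign kap = (\<Prod>j<c. (- 1) ^ la' j)"
  proof -
    have "sign rho * sign kap =
          (\<Prod>j<n. \<Prod>i<j. sgn (int (rho j) - int (rho i)) * sgn (int (kap j) - int (kap i)))"
      by (simp add: sign_eq_prod_sgn[OF rho] sign_eq_prod_sgn[OF kap] prod.distrib)
    also have "\<dots> = (\<Prod>j<n. \<Prod>i<j. if d \<le> j \<and> i < d \<and> i < la' (j - d) then - 1 else 1)"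
    proof (intro prod.cong refl)
      fix i j assume "j \<in> {..<n}" "i \<in> {..<j}"
      then have ij: "i < j" "j < n" by auto
      then consider "j < d" | "i < d" "d \<le> j" | "d \<le> i"
        by linarith
      then show "sgn (int (rho j) - int (rho i)) * sgn (int (kap j) - int (kap i)) =
                 (if d \<le> j \<and> i < d \<and> i < la' (j - d) then - 1 else 1)"
      proof cases
        case 1 then show ?thesis using be_dec[of i j] ij
          by (auto simp: rho_def kap_def sgn_if)
      next
        case 2
        then have "j - d < c" using ij by (auto simp: n_def)
        with 2 ij be_ga[of i "j - d"] show ?thesis
          by (auto simp: rho_def kap_def n_def sgn_if split: if_splits)
      next
        case 3
        then have "i - d < j - d" "j - d < c" using ij by (auto simp: n_def)
        with 3 ij ga_inc[of "i - d" "j - d"] show ?thesis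
          by (auto simp: rho_def kap_def n_def sgn_if)
      qed
    qed
    also have "\<dots> = (\<Prod>j\<in>{d..<n}. \<Prod>i<j. if d \<le> j \<and> i < d \<and> i < la' (j - d) then - 1 else 1)"
      by (rule prod.mono_neutral_right) auto
    also have "\<dots> = (\<Prod>j\<in>{d..<n}. (- 1) ^ la' (j - d))"
    proof (intro prod.cong refl)
      fix j assume j: "j \<in> {d..<n}"
      then have "j - d < c" by (auto simp: n_def)
      with j have "la' (j - d) \<le> d" "d \<le> j"
        using la'_le by auto
      then have "(\<Prod>i<j. if d \<le> j \<and> i < d \<and> i < la' (j - d) then - 1 else 1) = (\<Prod>i<la' (j - d). - 1 :: int)"
        by (intro prod.mono_neutral_cong_right) (auto simp: n_def)
      then show "(\<Prod>i<j. if d \<le> j \<and> i < d \<and> i < la' (j - d) then - 1 else 1) = (- 1 :: int) ^ la' (j - d)"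
        by simp
    qed
    also have "\<dots> = (\<Prod>j<c. (- 1) ^ la' j)"
      by (rule prod.reindex_bij_witness[of _ "\<lambda>j. j + d" "\<lambda>j. j - d"]) (auto simp: n_def)
    finally show ?thesis .
  qed
  let ?A = "mat n n (\<lambda>(i, j). h (int (rho i) - int (kap j)))"
  \<comment> \<open>The first d columns of \<open>?M\<close> select columns of \<open>?A\<close>,
    the others are columns of its inverse. Thus \<open>?A * ?M\<close> and \<open>?M\<close> are
    both block triangular, one containing the h-determinant and the other a signed
    e-determinant.\<close>
  let ?M = "mat n n (\<lambda>(i, j). if j < d then if i = j then 1 else 0
              else (- 1) ^ (kap i + rho j) * e (int (kap i) - int (rho j)))"
  let ?T = "mat n n (\<lambda>(i, j). h (int i - int j))"
  have "det ?T = prod_list (diag_mat ?T)"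
    by (rule det_lower_triangular[where n = n]) (auto simp: h_neg)
  then have det_T: "det ?T = 1"
    by (simp add: diag_mat_def h_0 prod.list_conv_set_nth)
  have "det ?A = of_int (sign kap) * det (mat n n (\<lambda>(i, j). h (int (rho i) - int j)))"
    by (rule det_permute_cols[OF kap])
  also have "mat n n (\<lambda>(i, j). h (int (rho i) - int j)) = mat n n (\<lambda>(i, j). ?T $$ (rho i, j))"
    using rho_less by (intro eq_matI) auto
  also have "det \<dots> = of_int (sign rho) * det ?T"
    by (rule det_permute_rows) (use rho in auto)
  finally have det_A: "det ?A = (\<Prod>j<c. (- 1) ^ la' j)"
    using arg_cong[OF sign_rho_kap, of "of_int :: int \<Rightarrow> 'a"] by (simp add: det_T mult.commute)
  have AM: "?A * ?M = mat n n (\<lambda>(i, j). if j < d then h (int (rho i) - int (kap j))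
                         else if i = j then 1 else 0)" (is "_ = ?P")
  proof (rule eq_matI)
    fix i j assume ij: "i < dim_row ?P" "j < dim_col ?P"
    show "(?A * ?M) $$ (i, j) = ?P $$ (i, j)"
    proof (cases "j < d")
      case True
      have "(\<Sum>k = 0..<n. h (int (rho i) - int (kap k)) * (if k = j then 1 else 0)) =
            (\<Sum>k = 0..<n. if k = j then h (int (rho i) - int (kap j)) else 0)"
        by (rule sum.cong) auto
      also have "\<dots> = h (int (rho i) - int (kap j))"
        using ij by simp
      finally show ?thesis
        using ij True by (simp add: scalar_prod_def)
    next
      case False
      have "(\<Sum>k = 0..<n. h (int (rho i) - int (kap k)) * ((- 1) ^ (kap k + rho j) * e (int (kap k) - int (rho j))))
            = (\<Sum>k<n. h (int (rho i) - int k) * ((- 1) ^ (k + rho j) * e (int k - int (rho j))))"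
        using sum.permute[OF kap, of "\<lambda>k. h (int (rho i) - int k) * ((- 1) ^ (k + rho j) * e (int k - int (rho j)))"]
        by (simp add: o_def atLeast0LessThan)
      also have "\<dots> = (if rho i = rho j then 1 else 0)"
        using ij by (intro toeplitz_inverse) (auto simp: rho_less)
      also have "rho i = rho j \<longleftrightarrow> i = j"
        using permutes_inj[OF rho] by (auto dest: injD)
      finally show ?thesis
        using ij False by (simp add: scalar_prod_def)
    qed
  qed auto
  let ?H = "mat d d (\<lambda>(i, j). h (int (la ! i) + int j - int i))"
  let ?E = "mat c c (\<lambda>(i, j). (- 1) ^ (d + i + ga j) * e (int (d + i) - int (ga j)))"
  have "?P = four_block_mat ?H (0\<^sub>m d c) (mat c d (\<lambda>(i, j). ?P $$ (i + d, j))) (1\<^sub>m c)"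
    by (rule eq_matI) (auto simp: n_def rho_def kap_def be_def of_nat_diff algebra_simps)
  then have "det ?P = det ?H * det (1\<^sub>m c :: 'a mat)"
    using det_four_block_mat_upper_right_zero[of ?H d "0\<^sub>m d c" c
      "mat c d (\<lambda>(i, j). ?P $$ (i + d, j))" "1\<^sub>m c"] by simp
  then have det_P: "det ?P = det ?H" by simp
  have "?M = four_block_mat (1\<^sub>m d) (mat d c (\<lambda>(i, j). ?M $$ (i, j + d))) (0\<^sub>m c d) ?E"
    by (rule eq_matI) (auto simp: n_def rho_def kap_def)
  then have "det ?M = det (1\<^sub>m d :: 'a mat) * det ?E"
    using det_four_block_mat_lower_left_zero[of "1\<^sub>m d" d
      "mat d c (\<lambda>(i, j). ?M $$ (i, j + d))" c "0\<^sub>m c d" ?E] by simp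
  then have det_M: "det ?M = det ?E" by simp
  have "det ?E = det (mat c c (\<lambda>(i, j). (- 1) ^ (d + j + ga i) * e (int (d + j) - int (ga i))))"
    by (rule det_mat_transpose)
  also have "\<dots> = det (mat c c (\<lambda>(i, j). (- 1) ^ (i + la' i) * (- 1) ^ j * e (int (la' i) + int j - int i)))"
  proof (intro arg_cong[of _ _ det] eq_matI)
    fix i j assume "i < dim_row (mat c c (\<lambda>(i, j). (- 1) ^ (i + la' i) * (- 1) ^ j * e (int (la' i) + int j - int i)))"
      "j < dim_col (mat c c (\<lambda>(i, j). (- 1) ^ (i + la' i) * (- 1) ^ j * e (int (la' i) + int j - int i)))"
    then have ij: "i < c" "j < c" by auto
    have ga: "ga i + la' i = d + i"
      using la'_le[OF ij(1)] by (simp add: ga_def)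
    have "even (d + j + ga i) \<longleftrightarrow> even (i + la' i + j)"
      using arg_cong[OF ga, of even] by auto
    then have "(- 1 :: 'a) ^ (d + j + ga i) = (- 1) ^ (i + la' i + j)"
      by (simp only: minus_one_power_iff)
    moreover have "int (d + j) - int (ga i) = int (la' i) + int j - int i"
      using ga by linarith
    ultimately have "(- 1) ^ (d + j + ga i) * e (int (d + j) - int (ga i)) =
        (- 1) ^ (i + la' i) * (- 1) ^ j * e (int (la' i) + int j - int i)"
      by (simp only: power_add)
    then show "mat c c (\<lambda>(i, j). (- 1) ^ (d + j + ga i) * e (int (d + j) - int (ga i))) $$ (i, j) =
      mat c c (\<lambda>(i, j). (- 1) ^ (i + la' i) * (- 1) ^ j * e (int (la' i) + int j - int i)) $$ (i, j)"
      using ij by simp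
  qed auto
  also have "\<dots> = (\<Prod>j<c. (- 1) ^ (j + la' j)) * (\<Prod>j<c. (- 1) ^ j) *
                  det (mat c c (\<lambda>(i, j). e (int (la' i) + int j - int i)))"
    by (rule det_scale_rows_cols)
  \<comment> \<open>The factors (-1)^j from rows and columns cancel. The remaining sign is
    \<open>det ?A\<close>, and the two square to 1 below.\<close>
  also have "(\<Prod>j<c. (- 1) ^ (j + la' j)) * (\<Prod>j<c. (- 1) ^ j) = (\<Prod>j<c. (- 1 :: 'a) ^ la' j)"
    by (simp add: power_add mult_ac flip: prod.distrib power_mult_distrib)
  finally have det_E: "det ?E = (\<Prod>j<c. (- 1) ^ la' j) *
                  det (mat c c (\<lambda>(i, j). e (int (la' i) + int j - int i)))" .
  have "det (?A * ?M) = det ?A * det ?M"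
    by (rule det_mult[where n = n]) auto
  then have "det ?H = (\<Prod>j<c. (- 1) ^ la' j) * ((\<Prod>j<c. (- 1) ^ la' j) *
                  det (mat c c (\<lambda>(i, j). e (int (la' i) + int j - int i))))"
    unfolding AM det_P det_M det_A det_E .
  also have "\<dots> = det (mat c c (\<lambda>(i, j). e (int (la' i) + int j - int i)))"
    by (simp flip: mult.assoc prod.distrib power_mult_distrib)
  finally show ?thesis by (simp add: la'_def)
qed

end

context eh_pair begin

text \<open>A one-row partition has a conjugate consisting of ones. This is the link between h_k and
  the determinant defining Y_k.\<close>

lemma jacobi_trudi_single_row: "h (int k) = det (mat k k (\<lambda>(i, j). e (int i - int j + 1)))"
proof -
  have "[k] \<in> Sh 1 k" by (simp add: Sh_def)
  from dual_jacobi_trudi[OF this]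
  have "det (mat 1 1 (\<lambda>(i, j). h (int ([k] ! i) + int j - int i))) =
        det (mat k k (\<lambda>(i, j). e (int (conj_part k [k] ! i) + int j - int i)))" .
  also have "mat k k (\<lambda>(i, j). e (int (conj_part k [k] ! i) + int j - int i)) =
             mat k k (\<lambda>(i, j). e (int j - int i + 1))"
  proof (rule eq_matI)
    fix i j assume "i < dim_row (mat k k (\<lambda>(i, j). e (int j - int i + 1)))"
      and "j < dim_col (mat k k (\<lambda>(i, j). e (int j - int i + 1)))"
    moreover have "conj_part k [k] ! i = 1" if "i < k"
    proof -
      have "{l. l = 0 \<and> Suc i \<le> [k] ! l} = {0}" using that by auto
      then show ?thesis using that by (simp add: conj_part_def del: upt_Suc)
    qed
    ultimately show "mat k k (\<lambda>(i, j). e (int (conj_part k [k] ! i) + int j - int i)) $$ (i, j) =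
             mat k k (\<lambda>(i, j). e (int j - int i + 1)) $$ (i, j)"
      by (simp add: algebra_simps)
  qed auto
  also have "det (mat k k (\<lambda>(i, j). e (int j - int i + 1))) = det (mat k k (\<lambda>(i, j). e (int i - int j + 1)))"
    by (rule det_mat_transpose)
  finally show ?thesis by (simp add: det_single)
qed

end

subsection \<open>The Pieri rule\<close>

locale eh_pair_fin = eh_pair +
  fixes d :: nat
  assumes e_large: "k > int d \<Longrightarrow> e k = 0"
begin

text \<open>Since e vanishes beyond d and h below 0, one recurrence of fixed length d holds at every
  positive index, even below d.\<close>

lemma recurrence_fin:
  assumes "m > 0"
  shows "(\<Sum>i\<le>d. (-1) ^ i * e (int i) * h (m - int i)) = 0"
proof -
  have "(\<Sum>i\<le>d. (-1) ^ i * e (int i) * h (m - int i)) =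
        (\<Sum>i\<le>max d (nat m). (-1) ^ i * e (int i) * h (m - int i))"
    by (rule sum.mono_neutral_left) (auto simp: e_large)
  also have "\<dots> = (\<Sum>i\<le>nat m. (-1) ^ i * e (int i) * h (m - int i))"
    using assms by (intro sum.mono_neutral_right) (auto simp: h_neg)
  finally show ?thesis
    using assms recurrence[of "nat m"] by simp
qed

lemma recurrence_fin':
  assumes "m > 0"
  shows "h m = - (\<Sum>i\<in>{1..d}. (-1) ^ i * e (int i) * h (m - int i))"
proof -
  have "{..d} = insert 0 {1..d}" by auto
  then show ?thesis
    using recurrence_fin[OF assms] by (simp add: e_0 add_eq_0_iff2)
qed

definition hdet :: "(nat \<Rightarrow> nat) \<Rightarrow> 'a" where
  "hdet b = det (mat d d (\<lambda>(i, j). h (int (b i) + int j + 1 - int d)))"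

lemma hdet_cong: "(\<And>i. i < d \<Longrightarrow> b i = b' i) \<Longrightarrow> hdet b = hdet b'"
  unfolding hdet_def by (intro arg_cong[of _ _ det] eq_matI) auto

lemma hdet_eq_0:
  assumes "i < d" "j < d" "i \<noteq> j" "b i = b j"
  shows "hdet b = 0"
  unfolding hdet_def
  by (rule det_identical_rows[of _ d i j]) (use assms in \<open>auto intro!: eq_vecI\<close>)

lemma hdet_permute:
  assumes "p permutes {0..<d}"
  shows "hdet (b \<circ> p) = of_int (sign p) * hdet b"
proof -
  let ?A = "mat d d (\<lambda>(i, j). h (int (b i) + int j + 1 - int d))"
  have "mat d d (\<lambda>(i, j). h (int ((b \<circ> p) i) + int j + 1 - int d)) = mat d d (\<lambda>(i, j). ?A $$ (p i, j))"
    using permutes_in_image[OF assms] by (intro eq_matI) auto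
  then show ?thesis
    using det_permute_rows[of ?A d p] assms by (simp add: hdet_def)
qed

lemma hdet_base: "hdet (\<lambda>i. d - Suc i) = 1"
proof -
  let ?A = "mat d d (\<lambda>(i, j). h (int (d - Suc i) + int j + 1 - int d))"
  have "det ?A = prod_list (diag_mat ?A)"
    by (rule det_upper_triangular[of _ d]) (auto simp: upper_triangular_def h_neg)
  also have "\<dots> = 1"
    by (auto simp: diag_mat_def prod.list_conv_set_nth h_0 intro!: prod.neutral)
  finally show ?thesis by (simp add: hdet_def)
qed

text \<open>The exponents belong to the partition (1^r). Its conjugate has the single part r, so the
  dual determinant has size one.\<close>

lemma hdet_column:
  assumes "r \<le> d"
  shows "hdet (\<lambda>i. if i < r then Suc (d - Suc i) else d - Suc i) = e (int r)"
proof -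
  define la where "la = replicate r 1 @ replicate (d - r) (0 :: nat)"
  have len: "length la = d" using assms by (simp add: la_def)
  have nth: "la ! i = (if i < r then 1 else 0)" if "i < d" for i
    using that assms by (simp add: la_def nth_append)
  have "la \<in> Sh d 1"
    unfolding Sh_def using len nth by (auto simp: sorted_wrt_iff_nth_less in_set_conv_nth)
  note dual_jacobi_trudi[OF this]
  moreover have "mat d d (\<lambda>(i, j). h (int (la ! i) + int j - int i)) =
      mat d d (\<lambda>(i, j). h (int (if i < r then Suc (d - Suc i) else d - Suc i) + int j + 1 - int d))"
  proof (rule eq_matI, goal_cases)
    case (1 i j)
    then have "int (la ! i) + int j - int i =
        int (if i < r then Suc (d - Suc i) else d - Suc i) + int j + 1 - int d"
      using nth[of i] by auto
    then have "h (int (la ! i) + int j - int i) =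
        h (int (if i < r then Suc (d - Suc i) else d - Suc i) + int j + 1 - int d)"
      by (rule arg_cong)
    with 1 show ?case by (simp only: index_mat dim_row_mat dim_col_mat prod.case)
  qed auto
  moreover have "{i. i < d \<and> Suc 0 \<le> la ! i} = {..<r}"
    using assms nth by (auto split: if_splits)
  then have "conj_part 1 la = [r]"
    by (simp add: conj_part_def len)
  ultimately show ?thesis
    by (simp add: hdet_def det_single)
qed

text \<open>If S is not an initial segment, some i outside S is followed by i + 1 in S; raising only
  the second makes the two rows equal.\<close>

lemma hdet_add_subset_column:
  assumes "S \<subseteq> {..<d}" "S \<noteq> {..<card S}"
  shows "hdet (\<lambda>i. if i \<in> S then Suc (d - Suc i) else d - Suc i) = 0"
proof -
  have "finite S" using assms(1) finite_subset by blast
  have "\<exists>i. i \<notin> S \<and> Suc i \<in> S"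
  proof (rule ccontr)
    assume "\<not> ?thesis"
    then have step: "i \<in> S" if "Suc i \<in> S" for i using that by blast
    have down: "j \<in> S" if "i \<in> S" "j \<le> i" for i j
      using that(2,1) by (induction rule: inc_induct) (blast intro: step)+
    have "S = {..<card S}"
    proof (cases "S = {}")
      case False
      then have "S = {..Max S}"
        using \<open>finite S\<close> down[of "Max S"] by (intro equalityI subsetI) simp_all
      then show ?thesis by (metis card_atMost lessThan_Suc_atMost)
    qed simp
    with assms(2) show False ..
  qed
  then obtain i where i: "i \<notin> S" "Suc i \<in> S" by blast
  then show ?thesis
    using assms(1) by (intro hdet_eq_0[of i "Suc i"]) auto
qed

text \<open>The rows of \<open>hdet\<close> are moved by \<open>b \<mapsto> b + 1\<close> through the companion matrix \<open>C\<close> of the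
  recurrence, so the sum over \<open>S\<close> is a coefficient of \<open>hdet b * det (1 + t C)\<close>; the staircase
  \<open>b\<close> identifies that coefficient of \<open>det (1 + t C)\<close> as \<open>e r\<close>.\<close>

lemma pieri:
  assumes "r \<le> d"
  shows "e (int r) * hdet b =
         (\<Sum>S | S \<subseteq> {..<d} \<and> card S = r. hdet (\<lambda>i. if i \<in> S then Suc (b i) else b i))"
proof -
  define R where "R m j = h (int m + int j + 1 - int d)" for m j
  \<comment> \<open>Every column but the last only shifts the index by one; the last expresses the
    new entry through the d previous ones by the recurrence.\<close>
  define C where "C l j = (if Suc j < d then if l = Suc j then 1 else 0
                           else - ((-1) ^ (d - l) * e (int (d - l))))" for l j
  have R_Suc: "R (Suc m) j = (\<Sum>l<d. R m l * C l j)" if "j < d" for m j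
  proof (cases "Suc j < d")
    case True
    then have "(\<Sum>l<d. R m l * C l j) = (\<Sum>l<d. if l = Suc j then R m (Suc j) else 0)"
      by (intro sum.cong) (auto simp: C_def)
    with True show ?thesis by (simp add: R_def algebra_simps)
  next
    case False
    then have j: "Suc j = d" using that by simp
    have "int (Suc m) + int j + 1 - int d = int m + 1"
      using j by linarith
    then have "R (Suc m) j = - (\<Sum>i\<in>{1..d}. (-1) ^ i * e (int i) * h (int m + 1 - int i))"
      unfolding R_def by (simp only:) (rule recurrence_fin', simp)
    also have "(\<Sum>i\<in>{1..d}. (-1) ^ i * e (int i) * h (int m + 1 - int i)) =
               (\<Sum>l<d. R m l * ((-1) ^ (d - l) * e (int (d - l))))"
      by (rule sum.reindex_bij_witness[of _ "\<lambda>l. d - l" "\<lambda>i. d - i"])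
         (auto simp: R_def of_nat_diff algebra_simps)
    finally show ?thesis using False by (simp add: C_def sum_negf)
  qed
  define K where "K = mat d d (\<lambda>(l, j). [: if l = j then 1 else 0, C l j :])"
  define up where "up b S = (\<lambda>i. if i \<in> S then Suc (b i) else b i)" for b :: "nat \<Rightarrow> nat" and S
  have hdet_R: "hdet b = det (mat d d (\<lambda>(i, j). R (b i) j))" for b
    by (simp add: hdet_def R_def)
  \<comment> \<open>Row i of \<open>?M\<close> below is R (b i) + t R (b i + 1). Expanding each
    product of the Leibniz formula chooses the set S of raised rows, and the degree in t is
    \<open>card S\<close>.\<close>
  have main: "(\<Sum>S\<in>Pow {..<d}. monom (hdet (up b S)) (card S)) = [:hdet b:] * det K" for b
  proof -
    let ?M = "mat d d (\<lambda>(i, j). [: R (b i) j, R (Suc (b i)) j :])"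
    let ?B = "mat d d (\<lambda>(i, j). R (b i) j)"
    have "?M = map_mat (\<lambda>x. [:x:]) ?B * K"
    proof (rule eq_matI, goal_cases)
      case (1 i j)
      then have ij: "i < d" "j < d" by (auto simp: K_def)
      have *: "(\<Sum>l<d. (if l = j then 1 else 0) * R (b i) l) = (\<Sum>l<d. if l = j then R (b i) j else 0)"
        by (rule sum.cong) auto
      have "(\<Sum>l = 0..<d. [:R (b i) l:] * [: if l = j then 1 else 0, C l j :]) =
            [: \<Sum>l<d. (if l = j then 1 else 0) * R (b i) l, \<Sum>l<d. R (b i) l * C l j :]"
        by (auto simp: poly_eq_iff coeff_sum coeff_pCons atLeast0LessThan mult.commute
            simp del: sum.delta intro!: sum.cong split: nat.splits)
      then have "(\<Sum>l = 0..<d. [:R (b i) l:] * [: if l = j then 1 else 0, C l j :]) =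
            [: R (b i) j, R (Suc (b i)) j :]"
        unfolding * using ij by (simp add: R_Suc)
      then show ?case
        using ij by (simp only: K_def) (simp add: scalar_prod_def)
    qed (auto simp: K_def)
    then have "det ?M = det (map_mat (\<lambda>x. [:x:]) ?B) * det K"
      by (simp add: det_mult[of _ d] K_def)
    also have "det (map_mat (\<lambda>x. [:x:]) ?B) = [:hdet b:]"
    proof -
      interpret comm_ring_hom "\<lambda>x :: 'a. [:x:]"
        by unfold_locales (auto simp: one_pCons)
      show ?thesis by (simp add: hdet_R)
    qed
    finally have "[:hdet b:] * det K = det ?M" ..
    also have "\<dots> = (\<Sum>p | p permutes {0..<d}. of_int (sign p) * (\<Prod>i = 0..<d. [: R (b i) (p i), R (Suc (b i)) (p i) :]))"
      by (subst det_def'[of _ d]) (auto simp: permutes_in_image intro!: sum.cong prod.cong)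
    also have "\<dots> = (\<Sum>p | p permutes {0..<d}. \<Sum>S\<in>Pow {..<d}.
                     of_int (sign p) * monom (\<Prod>i = 0..<d. R (up b S i) (p i)) (card S))"
    proof (intro sum.cong refl)
      fix p
      have "(\<Prod>i = 0..<d. [: R (b i) (p i), R (Suc (b i)) (p i) :]) =
            (\<Prod>i\<in>{..<d}. monom (R (Suc (b i)) (p i)) 1 + [: R (b i) (p i) :])"
        by (auto simp: atLeast0LessThan monom_altdef intro!: prod.cong)
      also have "\<dots> = (\<Sum>S\<in>Pow {..<d}. (\<Prod>i\<in>S. monom (R (Suc (b i)) (p i)) 1) * (\<Prod>i\<in>{..<d} - S. [: R (b i) (p i) :]))"
        by (rule prod_add) simp
      also have "\<dots> = (\<Sum>S\<in>Pow {..<d}. monom (\<Prod>i = 0..<d. R (up b S i) (p i)) (card S))"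
      proof (rule sum.cong)
        fix S assume S: "S \<in> Pow {..<d}"
        then have fin: "finite S" by (auto intro: finite_subset)
        have 1: "(\<Prod>i\<in>S. monom (R (Suc (b i)) (p i)) 1) = monom (\<Prod>i\<in>S. R (Suc (b i)) (p i)) (card S)"
          using fin by (induction S rule: finite_induct) (auto simp: mult_monom monom_0 one_pCons)
        have 2: "(\<Prod>i\<in>T. [: R (b i) (p i) :]) = [: \<Prod>i\<in>T. R (b i) (p i) :]" for T
          by (induction T rule: infinite_finite_induct) (auto simp: one_pCons)
        have "(\<Prod>i = 0..<d. R (up b S i) (p i)) = (\<Prod>i\<in>S \<union> ({..<d} - S). R (up b S i) (p i))"
          using S by (intro prod.cong) auto
        also have "\<dots> = (\<Prod>i\<in>S. R (up b S i) (p i)) * (\<Prod>i\<in>{..<d} - S. R (up b S i) (p i))"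
          using fin by (intro prod.union_disjoint) auto
        also have "\<dots> = (\<Prod>i\<in>S. R (Suc (b i)) (p i)) * (\<Prod>i\<in>{..<d} - S. R (b i) (p i))"
          by (auto simp: up_def intro!: arg_cong2[of _ _ _ _ "(*)"] prod.cong)
        finally show "(\<Prod>i\<in>S. monom (R (Suc (b i)) (p i)) 1) * (\<Prod>i\<in>{..<d} - S. [: R (b i) (p i) :]) =
              monom (\<Prod>i = 0..<d. R (up b S i) (p i)) (card S)"
          unfolding 1 2 by (simp add: smult_monom mult.commute)
      qed simp
      finally show "of_int (sign p) * (\<Prod>i = 0..<d. [: R (b i) (p i), R (Suc (b i)) (p i) :]) =
        (\<Sum>S\<in>Pow {..<d}. of_int (sign p) * monom (\<Prod>i = 0..<d. R (up b S i) (p i)) (card S))"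
        by (simp add: sum_distrib_left)
    qed
    also have "\<dots> = (\<Sum>S\<in>Pow {..<d}. \<Sum>p | p permutes {0..<d}.
                     of_int (sign p) * monom (\<Prod>i = 0..<d. R (up b S i) (p i)) (card S))"
      by (rule sum.swap)
    also have "\<dots> = (\<Sum>S\<in>Pow {..<d}. monom (hdet (up b S)) (card S))"
    proof (intro sum.cong refl)
      fix S
      have "hdet (up b S) = (\<Sum>p | p permutes {0..<d}. of_int (sign p) * (\<Prod>i = 0..<d. R (up b S i) (p i)))"
        unfolding hdet_R
        by (subst det_def'[of _ d]) (auto simp: permutes_in_image intro!: sum.cong prod.cong)
      then show "(\<Sum>p | p permutes {0..<d}. of_int (sign p) * monom (\<Prod>i = 0..<d. R (up b S i) (p i)) (card S)) =
            monom (hdet (up b S)) (card S)"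
        by (simp add: monom_sum) (simp add: of_int_poly smult_monom)
    qed
    finally show ?thesis ..
  qed
  have coeff: "(\<Sum>S | S \<subseteq> {..<d} \<and> card S = r. hdet (up b S)) = hdet b * coeff (det K) r" for b
  proof -
    have "hdet b * coeff (det K) r = coeff ([:hdet b:] * det K) r" by simp
    also have "\<dots> = (\<Sum>S\<in>Pow {..<d}. if card S = r then hdet (up b S) else 0)"
      unfolding main[symmetric] by (simp add: coeff_sum)
    also have "\<dots> = (\<Sum>S | S \<subseteq> {..<d} \<and> card S = r. hdet (up b S))"
      by (rule sum.mono_neutral_cong_right) auto
    finally show ?thesis ..
  qed
  have "(\<Sum>S | S \<subseteq> {..<d} \<and> card S = r. hdet (up (\<lambda>i. d - Suc i) S)) =
        (\<Sum>S\<in>{{..<r}}. hdet (up (\<lambda>i. d - Suc i) S))"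
  proof (rule sum.mono_neutral_right)
    show "\<forall>S\<in>{S. S \<subseteq> {..<d} \<and> card S = r} - {{..<r}}. hdet (up (\<lambda>i. d - Suc i) S) = 0"
      using hdet_add_subset_column unfolding up_def by blast
  qed (use assms in auto)
  also have "\<dots> = e (int r)"
    using hdet_column[OF assms] by (simp add: up_def)
  finally have "coeff (det K) r = e (int r)"
    unfolding coeff hdet_base by simp
  then show ?thesis
    using coeff[of b] by (simp add: up_def mult.commute)
qed

end

text \<open>F plays the role of E(-t), whence the alternating sign in the first sequence.\<close>

lemma eh_pair_fps:
  fixes F G :: "'a::idom fps"
  assumes "F * G = 1" "F $ 0 = 1"
  shows "eh_pair (\<lambda>k. if k < 0 then 0 else (-1) ^ nat k * F $ nat k) (\<lambda>k. if k < 0 then 0 else G $ nat k)"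
proof
  show "(if (0::int) < 0 then 0 else G $ nat 0) = 1"
    using arg_cong[OF assms(1), of "\<lambda>f. fps_nth f 0"] assms(2) by simp
  fix m :: nat assume "m > 0"
  then have "0 = (F * G) $ m" using assms(1) by simp
  also have "\<dots> = (\<Sum>i\<le>m. F $ i * G $ (m - i))"
    by (simp add: fps_mult_nth atLeast0AtMost)
  also have "\<dots> = (\<Sum>i\<le>m. (- 1) ^ i * (if int i < 0 then 0 else (- 1) ^ nat (int i) * F $ nat (int i)) *
        (if int m - int i < 0 then 0 else G $ nat (int m - int i)))"
    by (intro sum.cong) (auto simp: nat_diff_distrib simp flip: mult.assoc power_mult_distrib)
  finally show "(\<Sum>i\<le>m. (- 1) ^ i * (if int i < 0 then 0 else (- 1) ^ nat (int i) * F $ nat (int i)) *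
        (if int m - int i < 0 then 0 else G $ nat (int m - int i))) = 0" ..
qed (use assms in auto)

subsection \<open>The polynomial ring and evaluation\<close>

text \<open>P is an arbitrary set, because the lemma serves both the carrier of the polynomial ring
  and the set of multipliers that preserve the span of the q^k s_nu.\<close>

lemma det_closed:
  fixes A :: "'a::comm_ring_1 mat"
  assumes "A \<in> carrier_mat n n" "\<And>i j. i < n \<Longrightarrow> j < n \<Longrightarrow> A $$ (i, j) \<in> P"
    and one: "1 \<in> P" and add: "\<And>a b. a \<in> P \<Longrightarrow> b \<in> P \<Longrightarrow> a + b \<in> P"
    and mult: "\<And>a b. a \<in> P \<Longrightarrow> b \<in> P \<Longrightarrow> a * b \<in> P"
    and uminus: "\<And>a. a \<in> P \<Longrightarrow> - a \<in> P"
  shows "det A \<in> P"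
proof -
  have zero: "0 \<in> P"
    using add[OF one uminus[OF one]] by simp
  have prod: "prod f S \<in> P" if "\<And>x. x \<in> S \<Longrightarrow> f x \<in> P" for f :: "nat \<Rightarrow> 'a" and S
    using that by (induction S rule: infinite_finite_induct) (auto intro: one mult)
  have sum: "sum f S \<in> P" if "\<And>x. x \<in> S \<Longrightarrow> f x \<in> P" for f :: "(nat \<Rightarrow> nat) \<Rightarrow> 'a" and S
    using that by (induction S rule: infinite_finite_induct) (auto intro: zero add)
  have "(\<Prod>i = 0..<n. A $$ (i, p i)) \<in> P" if "p permutes {0..<n}" for p
    using assms(2) permutes_in_image[OF that] by (intro prod) auto
  then have "of_int (sign p) * (\<Prod>i = 0..<n. A $$ (i, p i)) \<in> P" if "p permutes {0..<n}" for p
    using that uminus by (auto simp: sign_def)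
  then show ?thesis
    unfolding det_def'[OF assms(1)] by (intro sum) auto
qed

section \<open>Evaluation of polynomials at a point\<close>

definition mono_eval :: "(nat \<Rightarrow> 'a::comm_semiring_1) \<Rightarrow> (nat \<Rightarrow>\<^sub>0 nat) \<Rightarrow> 'a" where
  "mono_eval x m = (\<Prod>i\<in>Poly_Mapping.keys m. x i ^ Poly_Mapping.lookup m i)"

lemma mono_eval_superset:
  assumes "finite S" "Poly_Mapping.keys m \<subseteq> S"
  shows "mono_eval x m = (\<Prod>i\<in>S. x i ^ Poly_Mapping.lookup m i)"
  unfolding mono_eval_def by (rule prod.mono_neutral_left) (use assms in \<open>auto simp: in_keys_iff\<close>)

lemma mono_eval_add: "mono_eval x (m + m') = mono_eval x m * mono_eval x m'"
proof -
  let ?S = "Poly_Mapping.keys m \<union> Poly_Mapping.keys m'"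
  have "mono_eval x (m + m') = (\<Prod>i\<in>?S. x i ^ Poly_Mapping.lookup (m + m') i)"
    by (rule mono_eval_superset) (auto simp: Poly_Mapping.keys_add)
  also have "\<dots> = (\<Prod>i\<in>?S. x i ^ Poly_Mapping.lookup m i) * (\<Prod>i\<in>?S. x i ^ Poly_Mapping.lookup m' i)"
    by (simp add: lookup_add power_add prod.distrib)
  finally show ?thesis
    by (simp add: mono_eval_superset[of ?S])
qed

definition poly_eval :: "(nat \<Rightarrow> 'a::comm_ring_1) \<Rightarrow> ((nat \<Rightarrow>\<^sub>0 nat) \<Rightarrow>\<^sub>0 'a) \<Rightarrow> 'a" where
  "poly_eval x p = (\<Sum>m\<in>Poly_Mapping.keys p. Poly_Mapping.lookup p m * mono_eval x m)"

lemma poly_eval_superset: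
  assumes "finite S" "Poly_Mapping.keys p \<subseteq> S"
  shows "poly_eval x p = (\<Sum>m\<in>S. Poly_Mapping.lookup p m * mono_eval x m)"
  unfolding poly_eval_def by (rule sum.mono_neutral_left) (use assms in \<open>auto simp: in_keys_iff\<close>)

lemma poly_eval_add: "poly_eval x (p + q) = poly_eval x p + poly_eval x q"
proof -
  let ?S = "Poly_Mapping.keys p \<union> Poly_Mapping.keys q"
  have "poly_eval x (p + q) = (\<Sum>m\<in>?S. Poly_Mapping.lookup (p + q) m * mono_eval x m)"
    by (rule poly_eval_superset) (auto simp: Poly_Mapping.keys_add)
  also have "\<dots> = (\<Sum>m\<in>?S. Poly_Mapping.lookup p m * mono_eval x m) + (\<Sum>m\<in>?S. Poly_Mapping.lookup q m * mono_eval x m)"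
    by (simp add: lookup_add distrib_right sum.distrib)
  finally show ?thesis
    by (simp add: poly_eval_superset[of ?S])
qed

lemma poly_eval_zero: "poly_eval x 0 = 0"
  by (simp add: poly_eval_def)

lemma poly_eval_sum: "poly_eval x (sum f A) = (\<Sum>a\<in>A. poly_eval x (f a))"
  by (induction A rule: infinite_finite_induct) (auto simp: poly_eval_zero poly_eval_add)

lemma poly_eval_single: "poly_eval x (Poly_Mapping.single m c) = c * mono_eval x m"
  by (subst poly_eval_superset[of "{m}"]) auto

lemma poly_mapping_eq_sum_single:
  "p = (\<Sum>m\<in>Poly_Mapping.keys p. Poly_Mapping.single m (Poly_Mapping.lookup p m))"
  by (rule poly_mapping_eqI) (auto simp: lookup_sum lookup_single when_def in_keys_iff)

lemma poly_eval_mult: "poly_eval x (p * q) = poly_eval x p * poly_eval x q"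
proof -
  let ?s = "\<lambda>p m. Poly_Mapping.single m (Poly_Mapping.lookup p m)"
  have "p * q = (\<Sum>m\<in>Poly_Mapping.keys p. ?s p m) * (\<Sum>m\<in>Poly_Mapping.keys q. ?s q m)"
    by (simp flip: poly_mapping_eq_sum_single)
  also have "poly_eval x \<dots> = (\<Sum>m\<in>Poly_Mapping.keys p. \<Sum>m'\<in>Poly_Mapping.keys q.
      (Poly_Mapping.lookup p m * mono_eval x m) * (Poly_Mapping.lookup q m' * mono_eval x m'))"
    by (simp add: sum_product mult_single poly_eval_sum poly_eval_single mono_eval_add mult_ac)
  finally show ?thesis
    by (simp add: poly_eval_def sum_product)
qed

lemma poly_eval_const: "poly_eval x (Poly_Mapping.single 0 c) = c"
  by (simp add: poly_eval_single mono_eval_def)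

lemma comm_ring_hom_poly_eval: "comm_ring_hom (poly_eval x)"
  using poly_eval_const[of x 1]
  by unfold_locales (auto simp: poly_eval_add poly_eval_mult poly_eval_zero)

section \<open>The polynomial ring in d variables as a structure with carrier\<close>

lemma cpoly_ring_simps:
  "carrier (cpoly_ring d) = {p. \<forall>m\<in>Poly_Mapping.keys p. Poly_Mapping.keys m \<subseteq> {1..d}}"
  "p \<otimes>\<^bsub>cpoly_ring d\<^esub> q = p * q" "p \<oplus>\<^bsub>cpoly_ring d\<^esub> q = p + q"
  "\<one>\<^bsub>cpoly_ring d\<^esub> = 1" "\<zero>\<^bsub>cpoly_ring d\<^esub> = 0"
  by (simp_all add: cpoly_ring_def ring_of_type_algebra_def)

lemma cpoly_carrier_add:
  assumes "p \<in> carrier (cpoly_ring d)" "q \<in> carrier (cpoly_ring d)"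
  shows "p + q \<in> carrier (cpoly_ring d)"
  using assms Poly_Mapping.keys_add[of p q] by (auto simp: cpoly_ring_simps)

lemma cpoly_carrier_mult:
  assumes "p \<in> carrier (cpoly_ring d)" "q \<in> carrier (cpoly_ring d)"
  shows "p * q \<in> carrier (cpoly_ring d)"
proof -
  have "Poly_Mapping.keys (m + m') \<subseteq> {1..d}"
    if "m \<in> Poly_Mapping.keys p" "m' \<in> Poly_Mapping.keys q" for m m'
    using that assms Poly_Mapping.keys_add[of m m'] unfolding cpoly_ring_simps by blast
  then show ?thesis
    using keys_mult[of p q] unfolding cpoly_ring_simps by blast
qed

lemma cpoly_carrier_uminus: "p \<in> carrier (cpoly_ring d) \<Longrightarrow> - p \<in> carrier (cpoly_ring d)"
  by (simp add: cpoly_ring_simps in_keys_iff)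

lemma cpoly_carrier_const: "Poly_Mapping.single 0 z \<in> carrier (cpoly_ring d)"
  by (auto simp: cpoly_ring_simps split: if_splits)

lemma cpoly_carrier_zero: "0 \<in> carrier (cpoly_ring d)"
  and cpoly_carrier_one: "1 \<in> carrier (cpoly_ring d)"
  by (auto simp: cpoly_ring_simps)

lemma cpoly_carrier_power: "p \<in> carrier (cpoly_ring d) \<Longrightarrow> p ^ k \<in> carrier (cpoly_ring d)"
  by (induction k) (auto intro: cpoly_carrier_one cpoly_carrier_mult)

lemma cpoly_carrier_sum:
  "(\<And>a. a \<in> A \<Longrightarrow> f a \<in> carrier (cpoly_ring d)) \<Longrightarrow> sum f A \<in> carrier (cpoly_ring d)"
  by (induction A rule: infinite_finite_induct) (auto intro: cpoly_carrier_zero cpoly_carrier_add)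

lemma X_poly_carrier: "X_poly d k \<in> carrier (cpoly_ring d)"
  by (auto simp: X_poly_def cpoly_ring_simps split: if_splits)

lemma cpoly_carrier_det:
  assumes "A \<in> carrier_mat n n" "\<And>i j. i < n \<Longrightarrow> j < n \<Longrightarrow> A $$ (i, j) \<in> carrier (cpoly_ring d)"
  shows "det A \<in> carrier (cpoly_ring d)"
  by (rule det_closed[OF assms])
     (auto intro: cpoly_carrier_one cpoly_carrier_add cpoly_carrier_mult cpoly_carrier_uminus)

lemma Y_poly_carrier: "Y_poly d k \<in> carrier (cpoly_ring d)"
  unfolding Y_poly_def by (rule cpoly_carrier_det[of _ k]) (auto intro: X_poly_carrier)

lemma cring_cpoly: "cring (cpoly_ring d)"
proof (rule cringI)
  show "abelian_group (cpoly_ring d)"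
  proof (rule abelian_groupI)
    fix x assume "x \<in> carrier (cpoly_ring d)"
    then show "\<exists>y\<in>carrier (cpoly_ring d). y \<oplus>\<^bsub>cpoly_ring d\<^esub> x = \<zero>\<^bsub>cpoly_ring d\<^esub>"
      by (intro bexI[of _ "- x"]) (auto simp: cpoly_ring_simps(2-) intro: cpoly_carrier_uminus)
  qed (auto simp: cpoly_ring_simps(2-) add_ac intro: cpoly_carrier_add cpoly_carrier_zero)
  show "comm_monoid (cpoly_ring d)"
    by (rule comm_monoidI)
       (auto simp: cpoly_ring_simps(2-) mult_ac intro: cpoly_carrier_mult cpoly_carrier_one)
qed (auto simp: cpoly_ring_simps(2-) distrib_right)

lemma cpoly_a_inv: "p \<in> carrier (cpoly_ring d) \<Longrightarrow> \<ominus>\<^bsub>cpoly_ring d\<^esub> p = - p"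
proof -
  assume p: "p \<in> carrier (cpoly_ring d)"
  interpret cring "cpoly_ring d" by (rule cring_cpoly)
  show ?thesis
    using p by (intro minus_equality) (auto simp: cpoly_ring_simps(2-) intro: cpoly_carrier_uminus)
qed

subsection \<open>The ideal\<close>

lemma ideal_Lambda: "ideal (Lambda_ideal d n) (cpoly_ring d)"
proof -
  interpret cring "cpoly_ring d" by (rule cring_cpoly)
  show ?thesis
    unfolding Lambda_ideal_def by (rule genideal_ideal) (auto intro: Y_poly_carrier)
qed

lemma Lambda_ideal_Y: "n - d < k \<Longrightarrow> k < n \<Longrightarrow> Y_poly d k \<in> Lambda_ideal d n"
proof -
  assume k: "n - d < k" "k < n"
  interpret cring "cpoly_ring d" by (rule cring_cpoly)
  have "Y_poly d ` {n - d + 1..n - 1} \<subseteq> Lambda_ideal d n"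
    unfolding Lambda_ideal_def by (rule genideal_self) (auto intro: Y_poly_carrier)
  then show ?thesis using k by auto
qed

lemma Lambda_ideal_zero: "0 \<in> Lambda_ideal d n"
  and Lambda_ideal_add: "p \<in> Lambda_ideal d n \<Longrightarrow> q \<in> Lambda_ideal d n \<Longrightarrow> p + q \<in> Lambda_ideal d n"
  and Lambda_ideal_mult: "a \<in> carrier (cpoly_ring d) \<Longrightarrow> p \<in> Lambda_ideal d n \<Longrightarrow> a * p \<in> Lambda_ideal d n"
proof -
  note ideal = ideal_Lambda[of d n]
  note subgroup = ideal.axioms(1)[OF ideal]
  show "0 \<in> Lambda_ideal d n"
    using additive_subgroup.zero_closed[OF subgroup] by (simp add: cpoly_ring_simps)
  show "p \<in> Lambda_ideal d n \<Longrightarrow> q \<in> Lambda_ideal d n \<Longrightarrow> p + q \<in> Lambda_ideal d n"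
    using additive_subgroup.a_closed[OF subgroup, of p q] by (simp only: cpoly_ring_simps(3))
  show "a \<in> carrier (cpoly_ring d) \<Longrightarrow> p \<in> Lambda_ideal d n \<Longrightarrow> a * p \<in> Lambda_ideal d n"
    using ideal.I_l_closed[OF ideal, of p a] by (simp only: cpoly_ring_simps(2))
qed

lemma Lambda_ideal_sum: "(\<And>a. a \<in> A \<Longrightarrow> f a \<in> Lambda_ideal d n) \<Longrightarrow> sum f A \<in> Lambda_ideal d n"
  by (induction A rule: infinite_finite_induct) (auto intro: Lambda_ideal_zero Lambda_ideal_add)

text \<open>The polynomials in the carrier that vanish at x form an ideal containing the generators,
  hence the generated ideal.\<close>

lemma poly_eval_Lambda_ideal:
  assumes "\<And>k. n - d < k \<Longrightarrow> k < n \<Longrightarrow> poly_eval x (Y_poly d k) = 0" and "p \<in> Lambda_ideal d n"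
  shows "poly_eval x p = 0"
proof -
  interpret cring "cpoly_ring d" by (rule cring_cpoly)
  interpret ev: comm_ring_hom "poly_eval x" by (rule comm_ring_hom_poly_eval)
  let ?K = "{p \<in> carrier (cpoly_ring d). poly_eval x p = 0}"
  have "ideal ?K (cpoly_ring d)"
  proof (rule idealI)
    show "subgroup ?K (add_monoid (cpoly_ring d))"
    proof
      fix p assume "p \<in> ?K"
      moreover from this have "inv\<^bsub>add_monoid (cpoly_ring d)\<^esub> p = - p"
        using cpoly_a_inv[of p d] unfolding a_inv_def by simp
      ultimately show "inv\<^bsub>add_monoid (cpoly_ring d)\<^esub> p \<in> ?K"
        by (simp add: ev.hom_uminus cpoly_carrier_uminus)
    qed (auto simp: cpoly_ring_simps(2-) cpoly_carrier_zero poly_eval_add intro: cpoly_carrier_add)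
  qed (auto simp: cpoly_ring_simps(2-) ring_axioms poly_eval_mult intro: cpoly_carrier_mult)
  moreover have "Y_poly d ` {n - d + 1..n - 1} \<subseteq> ?K"
    using assms(1) by (auto intro: Y_poly_carrier)
  ultimately have "Lambda_ideal d n \<subseteq> ?K"
    unfolding Lambda_ideal_def by (rule genideal_minimal)
  then show ?thesis using assms(2) by auto
qed

text \<open>Together with \<open>s_poly\<close> this gives polynomial representatives of the classes
  \<open>q_elem\<close> and \<open>s_elem\<close>.\<close>

definition Q_poly :: "nat \<Rightarrow> nat \<Rightarrow> cpoly" where
  "Q_poly d n = (- 1) ^ (d + 1) * Y_poly d n"

definition s_poly :: "nat \<Rightarrow> nat \<Rightarrow> nat list \<Rightarrow> cpoly" where
  "s_poly d n la = det (mat (n - d) (n - d)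
       (\<lambda>(i, j). X_poly d (int (conj_part (n - d) la ! i) + int j - int i)))"

lemma s_poly_carrier: "s_poly d n la \<in> carrier (cpoly_ring d)"
  unfolding s_poly_def by (rule cpoly_carrier_det[of _ "n - d"]) (auto intro: X_poly_carrier)

lemma Q_poly_carrier: "Q_poly d n \<in> carrier (cpoly_ring d)"
  unfolding Q_poly_def
  by (intro cpoly_carrier_mult cpoly_carrier_power Y_poly_carrier cpoly_carrier_uminus cpoly_carrier_one)

lemma cring_Lambda: "cring (Lambda_ring d n)"
  unfolding Lambda_ring_def by (rule ideal.quotient_is_cring[OF ideal_Lambda cring_cpoly])

lemma Lambda_class_hom: "Lambda_class d n \<in> Ring.ring_hom (cpoly_ring d) (Lambda_ring d n)"
  using ideal.rcos_ring_hom[OF ideal_Lambda] unfolding Lambda_class_def Lambda_ring_def .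

lemma Lambda_class_eq_iff:
  assumes "p \<in> carrier (cpoly_ring d)" "q \<in> carrier (cpoly_ring d)"
  shows "Lambda_class d n p = Lambda_class d n q \<longleftrightarrow> p - q \<in> Lambda_ideal d n"
proof -
  interpret cring "cpoly_ring d" by (rule cring_cpoly)
  have "p \<ominus>\<^bsub>cpoly_ring d\<^esub> q = p - q"
    using assms by (simp add: a_minus_def cpoly_a_inv cpoly_ring_simps(2-))
  then show ?thesis
    using quotient_eq_iff_same_a_r_cos[OF ideal_Lambda assms, of n]
    unfolding Lambda_class_def by simp
qed

lemma Lambda_class_mult:
  assumes "p \<in> carrier (cpoly_ring d)" "q \<in> carrier (cpoly_ring d)"
  shows "Lambda_class d n p \<otimes>\<^bsub>Lambda_ring d n\<^esub> Lambda_class d n q = Lambda_class d n (p * q)"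
  using Ring.ring_hom_mult[OF Lambda_class_hom assms] by (simp add: cpoly_ring_simps(2))

lemma Lambda_class_closed:
  "p \<in> carrier (cpoly_ring d) \<Longrightarrow> Lambda_class d n p \<in> carrier (Lambda_ring d n)"
  by (rule Ring.ring_hom_closed[OF Lambda_class_hom])

lemma Lambda_class_power:
  assumes "p \<in> carrier (cpoly_ring d)"
  shows "Lambda_class d n p [^]\<^bsub>Lambda_ring d n\<^esub> (k :: nat) = Lambda_class d n (p ^ k)"
proof -
  interpret L: cring "Lambda_ring d n" by (rule cring_Lambda)
  show ?thesis
  proof (induction k)
    case 0
    then show ?case using Ring.ring_hom_one[OF Lambda_class_hom] by (simp add: cpoly_ring_simps)
  next
    case (Suc k)
    then show ?case
      using assms by (simp add: Lambda_class_mult cpoly_carrier_power mult.commute)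
  qed
qed

lemma Lambda_class_sum:
  assumes "finite A" "\<And>a. a \<in> A \<Longrightarrow> f a \<in> carrier (cpoly_ring d)"
  shows "finsum (Lambda_ring d n) (\<lambda>a. Lambda_class d n (f a)) A = Lambda_class d n (sum f A)"
proof -
  interpret L: cring "Lambda_ring d n" by (rule cring_Lambda)
  interpret P: cring "cpoly_ring d" by (rule cring_cpoly)
  show ?thesis
    using assms
  proof (induction A rule: finite_induct)
    case empty
    then show ?case
      using Ring.ring_hom_zero[OF Lambda_class_hom P.ring_axioms L.ring_axioms] by (simp add: cpoly_ring_simps)
  next
    case (insert a A)
    then show ?case
      using Ring.ring_hom_add[OF Lambda_class_hom, of "f a" d "sum f A" n]
      by (simp add: L.finsum_insert Lambda_class_closed cpoly_carrier_sum cpoly_ring_simps(3))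
  qed
qed

text \<open>The coset map is a ring homomorphism, so the sum in the quotient is the class of one
  polynomial. From here on the quotient enters only as membership in the ideal.\<close>

lemma is_expansion_iff:
  assumes "p \<in> carrier (cpoly_ring d)"
  shows "is_expansion d n (Lambda_class d n p) N \<longleftrightarrow>
     finite {(k, nu). N k nu \<noteq> 0} \<and> (\<forall>k nu. nu \<notin> Sh d (n - d) \<longrightarrow> N k nu = 0) \<and>
     p - (\<Sum>(k, nu) | N k nu \<noteq> 0. Poly_Mapping.single 0 (N k nu) *
            (Q_poly d n ^ k * s_poly d n (PD (n - d) nu))) \<in> Lambda_ideal d n"
proof -
  let ?t = "\<lambda>(k, nu). Poly_Mapping.single 0 (N k nu) * (Q_poly d n ^ k * s_poly d n (PD (n - d) nu))"
  let ?S = "{(k, nu). N k nu \<noteq> 0}"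
  have t: "?t x \<in> carrier (cpoly_ring d)" for x
    by (auto simp: case_prod_unfold intro!: cpoly_carrier_mult cpoly_carrier_const
        cpoly_carrier_power Q_poly_carrier s_poly_carrier)
  have "finsum (Lambda_ring d n)
           (\<lambda>(k, nu). Lambda_const d n (N k nu) \<otimes>\<^bsub>Lambda_ring d n\<^esub>
              (q_elem d n [^]\<^bsub>Lambda_ring d n\<^esub> k \<otimes>\<^bsub>Lambda_ring d n\<^esub>
               s_elem d n (PD (n - d) nu))) ?S = Lambda_class d n (sum ?t ?S)" if "finite ?S"
  proof -
    have "Lambda_const d n (N k nu) \<otimes>\<^bsub>Lambda_ring d n\<^esub>
              (q_elem d n [^]\<^bsub>Lambda_ring d n\<^esub> k \<otimes>\<^bsub>Lambda_ring d n\<^esub>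
               s_elem d n (PD (n - d) nu)) = Lambda_class d n (?t (k, nu))" for k nu
      unfolding q_elem_def s_elem_def Lambda_const_def Q_poly_def[symmetric] s_poly_def[symmetric]
      by (simp add: Lambda_class_mult Lambda_class_power cpoly_carrier_mult cpoly_carrier_const
        cpoly_carrier_power Q_poly_carrier s_poly_carrier)
    then show ?thesis
      using Lambda_class_sum[OF that, of ?t d n] t by (simp add: case_prod_unfold)
  qed
  moreover have "sum ?t ?S \<in> carrier (cpoly_ring d)"
    by (rule cpoly_carrier_sum) (rule t)
  ultimately show ?thesis
    unfolding is_expansion_def using Lambda_class_eq_iff[OF assms, of "sum ?t ?S" n] by auto
qed

subsection \<open>Existence of the expansion\<close>

text \<open>The coefficients of 1 / E(-t), that is, the complete homogeneous polynomials written in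
  the elementary ones X_i. The argument 1 of \<open>fps_right_inverse\<close> is the inverse of the
  constant coefficient.\<close>

definition h_poly :: "nat \<Rightarrow> int \<Rightarrow> cpoly" where
  "h_poly d k = (if k < 0 then 0 else
     fps_nth (fps_right_inverse (Abs_fps (\<lambda>i. (- 1) ^ i * X_poly d (int i))) 1) (nat k))"

lemma eh_pair_fin_X_poly: "eh_pair_fin (X_poly d) (h_poly d) d"
proof -
  let ?F = "Abs_fps (\<lambda>i. (- 1) ^ i * X_poly d (int i))"
  have F0: "fps_nth ?F 0 = 1" by (simp add: X_poly_def)
  have "?F * fps_right_inverse ?F 1 = 1"
    by (rule fps_right_inverse) (simp add: X_poly_def)
  from eh_pair_fps[OF this F0]
  have "eh_pair (\<lambda>k. if k < 0 then 0 else (- 1) ^ nat k * fps_nth ?F (nat k)) (h_poly d)"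
    by (simp only: h_poly_def[abs_def])
  also have "(\<lambda>k. if k < 0 then 0 else (- 1) ^ nat k * fps_nth ?F (nat k)) = X_poly d"
    by (auto simp: X_poly_def fun_eq_iff simp flip: mult.assoc power_mult_distrib)
  finally interpret eh_pair "X_poly d" "h_poly d" .
  show ?thesis by unfold_locales (simp add: X_poly_def)
qed

section \<open>Strictly decreasing exponents and partitions in a box\<close>

lemma strict_decreasing_gap:
  fixes b :: "nat \<Rightarrow> nat"
  assumes dec: "\<And>i j. i < j \<Longrightarrow> j < d \<Longrightarrow> b j < b i" and "i \<le> j" "j < d"
  shows "b j + (j - i) \<le> b i"
  using \<open>i \<le> j\<close> \<open>j < d\<close>
proof (induction j rule: dec_induct)
  case (step j)
  then show ?case using dec[of j "Suc j"] by auto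
qed simp

text \<open>Subtract d - 1, ..., 1, 0. Strict decrease keeps the result nonnegative and weakly
  decreasing, and b 0 < n bounds its first part by n - d.\<close>

lemma Sh_of_strict_decreasing:
  assumes dec: "\<And>i j. i < j \<Longrightarrow> j < d \<Longrightarrow> b j < b i" and less: "\<And>i. i < d \<Longrightarrow> b i < n" and "d \<le> n"
  obtains nu where "nu \<in> Sh d (n - d)" "\<And>i. i < d \<Longrightarrow> nu ! i + (d - Suc i) = b i"
proof
  let ?nu = "map (\<lambda>i. b i - (d - Suc i)) [0..<d]"
  have ge: "d - Suc i \<le> b i" if "i < d" for i
  proof -
    have "i \<le> d - 1" "d - 1 < d" using that by auto
    then have "b (d - 1) + (d - 1 - i) \<le> b i"
      by (intro strict_decreasing_gap[of d b] dec)
    then show ?thesis by simp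
  qed
  show "?nu ! i + (d - Suc i) = b i" if "i < d" for i
    using ge[OF that] that by simp
  have "b i - (d - Suc i) \<le> n - d" if "i < d" for i
    using strict_decreasing_gap[of d b 0 i, OF dec] less[of 0] that by simp
  moreover have "b j - (d - Suc j) \<le> b i - (d - Suc i)" if "i < j" "j < d" for i j
    using strict_decreasing_gap[of d b i j, OF dec] that by simp
  ultimately show "?nu \<in> Sh d (n - d)"
    by (auto simp: Sh_def sorted_wrt_iff_nth_less)
qed

lemma ex_permutes_decreasing:
  fixes b :: "nat \<Rightarrow> nat"
  assumes "inj_on b {0..<d}"
  obtains p where "p permutes {0..<d}" "\<And>i j. i < j \<Longrightarrow> j < d \<Longrightarrow> b (p j) < b (p i)"
proof -
  let ?xs = "map b [0..<d]"
  have "mset (rev (sort ?xs)) = mset ?xs" by simp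
  from mset_eq_permutation[OF this] obtain p
    where p: "p permutes {..<length ?xs}" "permute_list p ?xs = rev (sort ?xs)" .
  have p': "p permutes {0..<d}" using p(1) by (simp add: lessThan_atLeast0)
  have nth: "rev (sort ?xs) ! i = b (p i)" if "i < d" for i
    using permute_list_nth[of p ?xs i] p that permutes_in_image[OF p', of i] by simp
  have "distinct (rev (sort ?xs))"
    using assms by (simp add: distinct_map)
  moreover have "sorted_wrt (\<ge>) (rev (sort ?xs))"
    by (simp add: sorted_wrt_rev)
  ultimately have "rev (sort ?xs) ! j < rev (sort ?xs) ! i" if "i < j" "j < d" for i j
    using that by (auto simp: sorted_wrt_iff_nth_less distinct_conv_nth order_less_le)
  then show ?thesis
    using that[OF p'] nth by auto
qed

section \<open>Reduction of determinants modulo the ideal\<close>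

locale quantum =
  fixes d n :: nat
  assumes d_pos: "1 \<le> d" and d_less: "d < n"
begin

sublocale X: eh_pair_fin "X_poly d" "h_poly d" d
  by (rule eh_pair_fin_X_poly)

abbreviation P where "P \<equiv> carrier (cpoly_ring d)"
abbreviation I where "I \<equiv> Lambda_ideal d n"
abbreviation Q where "Q \<equiv> Q_poly d n"
abbreviation const :: "complex \<Rightarrow> cpoly" where "const z \<equiv> Poly_Mapping.single 0 z"

lemma h_poly_eq_Y: "h_poly d (int k) = Y_poly d k"
  unfolding X.jacobi_trudi_single_row Y_poly_def by simp

lemma h_poly_carrier: "h_poly d k \<in> P"
proof (cases "k < 0")
  case True
  then show ?thesis by (simp add: X.h_neg cpoly_carrier_zero)
next
  case False
  then show ?thesis using Y_poly_carrier[of d "nat k"] by (simp flip: h_poly_eq_Y)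
qed

lemma s_poly_eq_hdet:
  assumes "nu \<in> Sh d (n - d)"
  shows "s_poly d n nu = X.hdet (\<lambda>i. nu ! i + (d - Suc i))"
proof -
  have "s_poly d n nu = det (mat d d (\<lambda>(i, j). h_poly d (int (nu ! i) + int j - int i)))"
    unfolding s_poly_def X.dual_jacobi_trudi[OF assms] ..
  also have "mat d d (\<lambda>(i, j). h_poly d (int (nu ! i) + int j - int i)) =
    mat d d (\<lambda>(i, j). h_poly d (int (nu ! i + (d - Suc i)) + int j + 1 - int d))"
  proof (rule eq_matI, goal_cases)
    case (1 i j)
    then have "int (nu ! i) + int j - int i = int (nu ! i + (d - Suc i)) + int j + 1 - int d"
      by auto
    with 1 show ?case by (simp only: index_mat dim_row_mat dim_col_mat prod.case)
  qed auto
  finally show ?thesis by (simp only: X.hdet_def)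
qed

text \<open>Modulo \<open>I\<close> the sequence \<open>h (k - n)\<close>, scaled by \<open>h n\<close>, has the same \<open>d\<close> initial values
  at \<open>n - d + 1, \<dots>, n\<close> as \<open>h k\<close>, and both obey the same recurrence from there on.\<close>

lemma h_poly_shift:
  assumes "int n - int d < k"
  shows "h_poly d k - h_poly d (int n) * h_poly d (k - int n) \<in> I"
proof -
  have "h_poly d (int m) - h_poly d (int n) * h_poly d (int m - int n) \<in> I" if "n - d < m" for m
    using that
  proof (induction m rule: less_induct)
    case (less m)
    consider "m < n" | "m = n" | "n < m" by linarith
    then show ?case
    proof cases
      case 1
      then show ?thesis
        using Lambda_ideal_Y[of n d m] less.prems by (simp add: X.h_neg h_poly_eq_Y)
    next
      case 2
      then show ?thesis by (simp add: X.h_0 Lambda_ideal_zero)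
    next
      case 3
      \<comment> \<open>Here m and m - n are both positive, so both terms obey the recurrence; it
        reaches back to m - d > n - d, where the induction hypothesis applies.\<close>
      have "h_poly d (int m) - h_poly d (int n) * h_poly d (int m - int n) =
        (\<Sum>i\<in>{1..d}. (- ((-1) ^ i * X_poly d (int i))) *
          (h_poly d (int m - int i) - h_poly d (int n) * h_poly d (int m - int n - int i)))"
        using 3 X.recurrence_fin'[of "int m"] X.recurrence_fin'[of "int m - int n"]
        by (simp add: sum_negf sum_distrib_left algebra_simps flip: sum_subtractf)
      also have "\<dots> \<in> I"
      proof (intro Lambda_ideal_sum Lambda_ideal_mult)
        fix i assume i: "i \<in> {1..d}"
        then have "int m - int i = int (m - i)" "int m - int n - int i = int (m - i) - int n"
          using 3 d_less by auto
        moreover have "n - d < m - i" using i 3 d_less by auto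
        ultimately show "h_poly d (int m - int i) - h_poly d (int n) * h_poly d (int m - int n - int i) \<in> I"
          using less.IH[of "m - i"] i 3 d_less by (simp only:) simp
      qed (auto intro!: cpoly_carrier_uminus cpoly_carrier_mult cpoly_carrier_power cpoly_carrier_one X_poly_carrier)
      finally show ?thesis .
    qed
  qed
  from this[of "nat k"] assms d_less show ?thesis
    by (cases "k < 0") (auto simp: nat_diff_distrib)
qed

text \<open>The determinant is linear in row i. As n <= b i, all indices in that row exceed n - d,
  so \<open>h_poly_shift\<close> applies to each of its entries.\<close>

lemma hdet_shift:
  assumes "i < d" "n \<le> b i"
  shows "X.hdet b - h_poly d (int n) * X.hdet (b(i := b i - n)) \<in> I"
proof -
  define b' where "b' = b(i := b i - n)"
  let ?f = "\<lambda>b l j. h_poly d (int (b l) + int j + 1 - int d)"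
  let ?PR = "\<lambda>p. \<Prod>l\<in>{0..<d} - {i}. ?f b l (p l)"
  have det: "X.hdet c = (\<Sum>p | p permutes {0..<d}. of_int (sign p) * (\<Prod>l = 0..<d. ?f c l (p l)))" for c
    unfolding X.hdet_def
    by (subst det_def'[of _ d]) (auto simp: permutes_in_image intro!: sum.cong prod.cong)
  have split: "(\<Prod>l = 0..<d. ?f c l (p l)) = ?f c i (p i) * (\<Prod>l\<in>{0..<d} - {i}. ?f c l (p l))" for c p
    using assms by (intro prod.remove) auto
  have b': "(\<Prod>l\<in>{0..<d} - {i}. ?f b' l (p l)) = ?PR p" for p
    by (intro prod.cong) (auto simp: b'_def)
  have "X.hdet b - h_poly d (int n) * X.hdet b' = (\<Sum>p | p permutes {0..<d}.
     (of_int (sign p) * ?PR p) * (?f b i (p i) - h_poly d (int n) * ?f b' i (p i)))"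
    by (simp only: det split b') (simp add: sum_distrib_left algebra_simps flip: sum_subtractf)
  also have "\<dots> \<in> I"
  proof (intro Lambda_ideal_sum Lambda_ideal_mult)
    fix p
    show "of_int (sign p) * ?PR p \<in> P"
    proof -
      have "prod f S \<in> P" if "\<And>x. f x \<in> P" for f :: "nat \<Rightarrow> cpoly" and S
        using that by (induction S rule: infinite_finite_induct) (auto intro: cpoly_carrier_one cpoly_carrier_mult)
      from this[of "\<lambda>l. ?f b l (p l)"] have "?PR p \<in> P" using h_poly_carrier by blast
      then show ?thesis using cpoly_carrier_uminus by (auto simp: sign_def)
    qed
    have eq: "int (b' i) + int (p i) + 1 - int d = int (b i) + int (p i) + 1 - int d - int n"
      using assms by (simp add: b'_def)
    have "int n - int d < int (b i) + int (p i) + 1 - int d"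
      using assms by simp
    then show "?f b i (p i) - h_poly d (int n) * ?f b' i (p i) \<in> I"
      unfolding eq by (rule h_poly_shift)
  qed
  finally show ?thesis by (simp only: b'_def)
qed

text \<open>The preimage in the polynomial ring of the complex span of the classes q^k s_nu. Adding
  one term at a time turns closure properties into inductions.\<close>

inductive_set span :: "cpoly set" where
  span_ideal: "p \<in> I \<Longrightarrow> p \<in> span"
| span_step: "p \<in> span \<Longrightarrow> nu \<in> Sh d (n - d) \<Longrightarrow> p + const z * (Q ^ k * s_poly d n nu) \<in> span"

lemma const_mult: "const y * const z = const (y * z)"
  by (simp add: mult_single)

lemma span_add: "p \<in> span \<Longrightarrow> q \<in> span \<Longrightarrow> p + q \<in> span"
proof (induction p rule: span.induct)
  case (span_ideal p)
  from span_ideal(2,1) show ?case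
  proof (induction q rule: span.induct)
    case (span_ideal q)
    then show ?case by (intro span.span_ideal Lambda_ideal_add)
  next
    case (span_step q nu z k)
    then show ?case using span.span_step[of "p + q" nu z k] by (simp add: add.assoc)
  qed
next
  case (span_step p nu z k)
  then show ?case using span.span_step[of "p + q" nu z k] by (simp add: add_ac)
qed

lemma span_zero: "0 \<in> span"
  by (intro span_ideal Lambda_ideal_zero)

lemma span_sum: "(\<And>a. a \<in> A \<Longrightarrow> f a \<in> span) \<Longrightarrow> sum f A \<in> span"
  by (induction A rule: infinite_finite_induct) (auto intro: span_zero span_add)

lemma span_const: "p \<in> span \<Longrightarrow> const y * p \<in> span"
proof (induction p rule: span.induct)
  case (span_ideal p)
  then show ?case by (intro span.span_ideal Lambda_ideal_mult cpoly_carrier_const)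
next
  case (span_step p nu z k)
  from span.span_step[OF span_step(3,2), of "y * z" k] show ?case
    by (simp add: distrib_left const_mult flip: mult.assoc)
qed

lemma span_uminus: "p \<in> span \<Longrightarrow> - p \<in> span"
  using span_const[of p "- 1"] by (simp add: single_uminus)

lemma span_sign: "p \<in> span \<Longrightarrow> (- 1) ^ m * p \<in> span"
  by (cases "even m") (auto intro: span_uminus)

lemma span_Q: "p \<in> span \<Longrightarrow> Q * p \<in> span"
proof (induction p rule: span.induct)
  case (span_ideal p)
  then show ?case by (intro span.span_ideal Lambda_ideal_mult Q_poly_carrier)
next
  case (span_step p nu z k)
  from span.span_step[OF span_step(3,2), of z "Suc k"] show ?case
    by (simp add: algebra_simps)
qed

lemma span_Q_power: "p \<in> span \<Longrightarrow> Q ^ k * p \<in> span"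
  by (induction k) (auto simp: mult.assoc intro: span_Q)

lemma s_poly_in_span: "nu \<in> Sh d (n - d) \<Longrightarrow> s_poly d n nu \<in> span"
  using span_step[OF span_zero, of nu 1 0] by simp

text \<open>The measure is the sum of the exponents, which drops whenever an exponent is lowered by
  n. Once all are below n, equal exponents give 0 and distinct ones sort to a partition in the box,
  up to sign.\<close>

lemma hdet_in_span: "X.hdet b \<in> span"
proof (induction "\<Sum>i<d. b i" arbitrary: b rule: less_induct)
  case less
  show ?case
  proof (cases "\<exists>i<d. n \<le> b i")
    case True
    then obtain i where i: "i < d" "n \<le> b i" by blast
    let ?b = "b(i := b i - n)"
    have "(\<Sum>l<d. ?b l) < (\<Sum>l<d. b l)"
      by (rule sum_strict_mono_ex1) (use i d_less in auto)
    then have IH: "X.hdet ?b \<in> span" by (rule less)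
    have "h_poly d (int n) = (- 1) ^ (d + 1) * Q"
      by (simp add: h_poly_eq_Y Q_poly_def flip: mult.assoc power_mult_distrib)
    then have "X.hdet b = (X.hdet b - h_poly d (int n) * X.hdet ?b) + (- 1) ^ (d + 1) * (Q * X.hdet ?b)"
      by (simp add: algebra_simps)
    also have "\<dots> \<in> span"
      using hdet_shift[of i b] i by (intro span_add span_ideal span_sign span_Q IH)
    finally show ?thesis .
  next
    case False
    then have less_n: "b i < n" if "i < d" for i using that by auto
    show ?thesis
    proof (cases "inj_on b {0..<d}")
      case True
      then obtain p where p: "p permutes {0..<d}"
        and dec: "\<And>i j. i < j \<Longrightarrow> j < d \<Longrightarrow> b (p j) < b (p i)"
        by (rule ex_permutes_decreasing) blast
      have "p i < d" if "i < d" for i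
        using permutes_in_image[OF p, of i] that by simp
      then obtain nu where nu: "nu \<in> Sh d (n - d)" "\<And>i. i < d \<Longrightarrow> nu ! i + (d - Suc i) = b (p i)"
        using Sh_of_strict_decreasing[of d "\<lambda>i. b (p i)" n] dec less_n d_less by auto
      have "of_int (sign p) * X.hdet b = X.hdet (b \<circ> p)"
        by (simp add: X.hdet_permute[OF p])
      also have "\<dots> = s_poly d n nu"
        unfolding s_poly_eq_hdet[OF nu(1)] by (rule X.hdet_cong) (simp only: nu(2) o_apply)
      finally have "of_int (sign p) * X.hdet b \<in> span"
        using s_poly_in_span[OF nu(1)] by simp
      then show ?thesis
        using span_uminus by (fastforce simp: sign_def split: if_splits)
    next
      case False
      then obtain i j where "i < d" "j < d" "i \<noteq> j" "b i = b j"
        by (auto simp: inj_on_def)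
      from X.hdet_eq_0[OF this] show ?thesis by (simp add: span_zero)
    qed
  qed
qed

text \<open>Multiplication by X_r passes through constants and powers of q to s_nu. The summands of
  the Pieri rule may leave the box or have equal rows, but \<open>hdet_in_span\<close> covers all
  exponents.\<close>

lemma span_X_poly:
  assumes "p \<in> span"
  shows "X_poly d k * p \<in> span"
proof -
  have "X_poly d (int r) * p \<in> span" if r: "r \<le> d" for r
    using assms
  proof (induction p rule: span.induct)
    case (span_ideal p)
    then show ?case by (intro span.span_ideal Lambda_ideal_mult X_poly_carrier)
  next
    case (span_step p nu z m)
    have "X_poly d (int r) * s_poly d n nu \<in> span"
      unfolding s_poly_eq_hdet[OF span_step(2)] X.pieri[OF r] by (intro span_sum hdet_in_span)
    then have "X_poly d (int r) * p + const z * (Q ^ m * (X_poly d (int r) * s_poly d n nu)) \<in> span"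
      using span_step by (intro span_add span_const span_Q_power)
    then show ?case by (simp add: algebra_simps)
  qed
  from this[of "nat k"] show ?thesis
    by (cases "k < 0 \<or> k > int d") (auto simp: X_poly_def span_zero)
qed

text \<open>The multipliers that preserve the span are closed under the ring operations and contain
  all entries of the determinant defining s_la.\<close>

lemma span_s_poly_mult:
  assumes "p \<in> span"
  shows "s_poly d n la * p \<in> span"
proof -
  let ?T = "{f. \<forall>p\<in>span. f * p \<in> span}"
  have "s_poly d n la \<in> ?T"
    unfolding s_poly_def
    by (rule det_closed[of _ "n - d"])
       (auto simp: distrib_right mult.assoc intro: span_X_poly span_add span_uminus)
  then show ?thesis using assms by blast
qed

section \<open>Coefficient families from span membership\<close>

lemma PD_Sh: "nu \<in> Sh d c \<Longrightarrow> PD c nu \<in> Sh d c"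
  by (auto simp: Sh_def PD_def sorted_wrt_rev sorted_wrt_map elim!: sorted_wrt_mono_rel[rotated])

lemma PD_PD: "nu \<in> Sh d c \<Longrightarrow> PD c (PD c nu) = nu"
  by (auto simp: Sh_def PD_def rev_map intro!: map_idI)

lemma expansion_exists:
  assumes "p \<in> span"
  shows "\<exists>N. finite {(k, nu). N k nu \<noteq> (0 :: complex)} \<and> (\<forall>k nu. nu \<notin> Sh d (n - d) \<longrightarrow> N k nu = 0) \<and>
     p - (\<Sum>(k, nu) | N k nu \<noteq> 0. const (N k nu) * (Q ^ k * s_poly d n (PD (n - d) nu))) \<in> I"
  using assms
proof (induction p rule: span.induct)
  case (span_ideal p)
  then show ?case by (intro exI[of _ "\<lambda>_ _. 0"]) auto
next
  case (span_step p nu z k)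
  let ?b = "\<lambda>x. Q ^ fst x * s_poly d n (PD (n - d) (snd x))"
  obtain N where N: "finite {x. case_prod N x \<noteq> 0}" "\<And>k nu. nu \<notin> Sh d (n - d) \<Longrightarrow> N k nu = 0"
    "p - (\<Sum>x | case_prod N x \<noteq> 0. const (case_prod N x) * ?b x) \<in> I"
    using span_step(3) by (auto simp: case_prod_unfold)
  \<comment> \<open>The family attaches q^k s_(PD nu) to the index nu, so a multiple of s_nu is
    recorded at PD nu; PD is an involution.\<close>
  let ?x = "(k, PD (n - d) nu)"
  define N' where "N' x = case_prod N x + (if x = ?x then z else 0)" for x
  \<comment> \<open>Adding z may create or cancel a nonzero coefficient at \<open>?x\<close>, so
    both sums are extended to a common finite index set.\<close>
  let ?S = "insert ?x {x. case_prod N x \<noteq> 0}"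
  have sub: "{x. N' x \<noteq> 0} \<subseteq> ?S" "{x. case_prod N x \<noteq> 0} \<subseteq> ?S"
    by (auto simp: N'_def)
  have fin: "finite ?S" using N(1) by simp
  have "(\<Sum>x | N' x \<noteq> 0. const (N' x) * ?b x) = (\<Sum>x\<in>?S. const (N' x) * ?b x)"
    using fin sub(1) by (intro sum.mono_neutral_left) auto
  also have "\<dots> = (\<Sum>x\<in>?S. const (case_prod N x) * ?b x) + (\<Sum>x\<in>?S. if x = ?x then const z * ?b ?x else 0)"
    unfolding sum.distrib[symmetric]
    by (rule sum.cong) (auto simp: N'_def single_add distrib_right)
  also have "(\<Sum>x\<in>?S. if x = ?x then const z * ?b ?x else 0) = const z * (Q ^ k * s_poly d n nu)"
    using fin by (simp add: PD_PD[OF span_step(2)])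
  also have "(\<Sum>x\<in>?S. const (case_prod N x) * ?b x) = (\<Sum>x | case_prod N x \<noteq> 0. const (case_prod N x) * ?b x)"
    using fin sub(2) by (intro sum.mono_neutral_right) auto
  finally have sum: "(\<Sum>x | N' x \<noteq> 0. const (N' x) * ?b x) =
    (\<Sum>x | case_prod N x \<noteq> 0. const (case_prod N x) * ?b x) + const z * (Q ^ k * s_poly d n nu)" .
  show ?case
  proof (intro exI[of _ "\<lambda>k nu. N' (k, nu)"] conjI allI impI)
    show "finite {(k, nu). N' (k, nu) \<noteq> 0}"
      using finite_subset[OF sub(1) fin] by (simp add: case_prod_unfold)
    show "N' (k', nu') = 0" if "nu' \<notin> Sh d (n - d)" for k' nu'
      using that N(2) PD_Sh[OF span_step(2)] by (auto simp: N'_def)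
    show "p + const z * (Q ^ k * s_poly d n nu) -
      (\<Sum>(k, nu) | N' (k, nu) \<noteq> 0. const (N' (k, nu)) * (Q ^ k * s_poly d n (PD (n - d) nu))) \<in> I"
      using N(3) sum by (simp add: case_prod_unfold)
  qed
qed

theorem is_expansion_exists:
  assumes "mu \<in> Sh d (n - d)"
  shows "\<exists>N. is_expansion d n (s_elem d n la \<otimes>\<^bsub>Lambda_ring d n\<^esub> s_elem d n mu) N"
proof -
  have "s_elem d n la \<otimes>\<^bsub>Lambda_ring d n\<^esub> s_elem d n mu =
        Lambda_class d n (s_poly d n la * s_poly d n mu)"
    unfolding s_elem_def s_poly_def[symmetric] by (rule Lambda_class_mult) (rule s_poly_carrier)+
  moreover have "s_poly d n la * s_poly d n mu \<in> P"
    by (intro cpoly_carrier_mult s_poly_carrier)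
  ultimately show ?thesis
    using expansion_exists[OF span_s_poly_mult[OF s_poly_in_span[OF assms]], of la]
    by (simp only: is_expansion_iff)
qed

end

subsection \<open>The Cauchy--Binet formula\<close>

text \<open>These encode the d-element subsets of {0, ..., n - 1}: the choices of columns in the
  Cauchy-Binet formula, and later the index set I_(d,n) after a shift.\<close>

definition increasing_lists :: "nat \<Rightarrow> nat \<Rightarrow> nat list set" where
  "increasing_lists d n = {A. length A = d \<and> sorted_wrt (<) A \<and> set A \<subseteq> {..<n}}"

text \<open>An injective map factors uniquely as a permutation followed by the increasing
  enumeration of its image.\<close>

lemma bij_betw_increasing_lists_permutations:
  "bij_betw (\<lambda>(A, p). restrict (\<lambda>k. A ! p k) {0..<d}) (increasing_lists d n \<times> {p. p permutes {0..<d}})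
     {f \<in> PiE {0..<d} (\<lambda>_. {..<n}). inj_on f {0..<d}}"
proof (rule bij_betwI')
  fix x y assume "x \<in> increasing_lists d n \<times> {p. p permutes {0..<d}}"
    "y \<in> increasing_lists d n \<times> {p. p permutes {0..<d}}"
  then obtain A p B r where xy: "x = (A, p)" "y = (B, r)"
    and A: "length A = d" "sorted_wrt (<) A" and B: "length B = d" "sorted_wrt (<) B"
    and p: "p permutes {0..<d}" and r: "r permutes {0..<d}"
    by (auto simp: increasing_lists_def)
  have distinct: "distinct A" "distinct B" and sorted: "sorted A" "sorted B"
    using A B by (auto simp: strict_sorted_iff)
  have image: "(\<lambda>k. C ! q k) ` {0..<d} = set C" if "q permutes {0..<d}" "length C = d" for q and C :: "nat list"
    using permutes_image[OF that(1)] that(2)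
    by (metis atLeast0LessThan image_image lessThan_atLeast0 nth_image take_all order_refl)
  have "x = y" if eq: "restrict (\<lambda>k. A ! p k) {0..<d} = restrict (\<lambda>k. B ! r k) {0..<d}"
  proof -
    have nth: "A ! p k = B ! r k" if "k < d" for k
      using fun_cong[OF eq, of k] that by simp
    then have "(\<lambda>k. A ! p k) ` {0..<d} = (\<lambda>k. B ! r k) ` {0..<d}"
      by (intro image_cong) auto
    then have "set A = set B"
      using image[OF p A(1)] image[OF r B(1)] by simp
    then have "A = B"
      by (rule sorted_distinct_set_unique[OF sorted(1) distinct(1) sorted(2) distinct(2)])
    moreover have "p k = r k" for k
    proof (cases "k < d")
      case True
      then show ?thesis
        using nth[OF True] \<open>A = B\<close> distinct A permutes_in_image[OF p, of k] permutes_in_image[OF r, of k]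
        by (simp add: nth_eq_iff_index_eq)
    qed (use permutes_not_in[OF p, of k] permutes_not_in[OF r, of k] in simp)
    ultimately show ?thesis by (auto simp: xy)
  qed
  then show "((case x of (A, p) \<Rightarrow> restrict (\<lambda>k. A ! p k) {0..<d}) =
              (case y of (A, p) \<Rightarrow> restrict (\<lambda>k. A ! p k) {0..<d})) = (x = y)"
    by (auto simp: xy)
next
  fix x assume "x \<in> increasing_lists d n \<times> {p. p permutes {0..<d}}"
  then obtain A p where x: "x = (A, p)" and A: "length A = d" "sorted_wrt (<) A" "set A \<subseteq> {..<n}"
    and p: "p permutes {0..<d}"
    by (auto simp: increasing_lists_def)
  have less: "p k < d" if "k < d" for k
    using permutes_in_image[OF p, of k] that by simp
  moreover have "distinct A" using A by (auto simp: strict_sorted_iff)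
  moreover have "inj p" by (rule permutes_inj[OF p])
  ultimately have "inj_on (\<lambda>k. A ! p k) {0..<d}"
    using A by (intro inj_onI) (auto simp: nth_eq_iff_index_eq dest: injD)
  moreover have "A ! p k < n" if "k < d" for k
  proof -
    have "A ! p k \<in> set A" using less[OF that] A(1) by simp
    then show ?thesis using A(3) by auto
  qed
  ultimately show "(case x of (A, p) \<Rightarrow> restrict (\<lambda>k. A ! p k) {0..<d}) \<in>
      {f \<in> PiE {0..<d} (\<lambda>_. {..<n}). inj_on f {0..<d}}"
    by (auto simp: x inj_on_def)
next
  fix f assume f: "f \<in> {f \<in> PiE {0..<d} (\<lambda>_. {..<n}). inj_on f {0..<d}}"
  define A where "A = sorted_list_of_set (f ` {0..<d})"
  have len: "length A = d"
    using f by (simp add: A_def card_image)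
  have "mset (map f [0..<d]) = mset A"
    using f by (subst set_eq_iff_mset_eq_distinct[symmetric]) (auto simp: A_def distinct_map)
  then obtain p where p: "p permutes {..<length A}" "permute_list p A = map f [0..<d]"
    by (rule mset_eq_permutation)
  have "f k = A ! p k" if "k < d" for k
    using arg_cong[OF p(2), of "\<lambda>l. l ! k"] permute_list_nth[OF p(1), of k] that len by simp
  then have "restrict (\<lambda>k. A ! p k) {0..<d} = f"
    using f by (auto simp: fun_eq_iff PiE_def extensional_def)
  moreover have "A \<in> increasing_lists d n"
    using f len by (auto simp: increasing_lists_def A_def PiE_def)
  moreover have "p permutes {0..<d}"
    using p(1) len by (simp add: lessThan_atLeast0)
  ultimately show "\<exists>x\<in>increasing_lists d n \<times> {p. p permutes {0..<d}}.
      f = (case x of (A, p) \<Rightarrow> restrict (\<lambda>k. A ! p k) {0..<d})"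
    by (intro bexI[of _ "(A, p)"]) auto
qed

text \<open>Expanding the inner sums gives one term for each choice of an index per row. Choices
  with a repetition vanish through equal rows; the rest are grouped by image, and the permutations
  within a group assemble the first determinant.\<close>

theorem cauchy_binet:
  fixes f g :: "nat \<Rightarrow> nat \<Rightarrow> 'a::comm_ring_1"
  shows "det (mat d d (\<lambda>(k, l). \<Sum>a<n. f k a * g a l)) =
    (\<Sum>A\<in>increasing_lists d n. det (mat d d (\<lambda>(k, i). f k (A ! i))) * det (mat d d (\<lambda>(i, l). g (A ! i) l)))"
proof -
  let ?Perm = "{p. p permutes {0..<d}}"
  let ?PiE = "PiE {0..<d} (\<lambda>_. {..<n})"
  define F where "F w = (\<Prod>k = 0..<d. f k (w k)) * det (mat d d (\<lambda>(k, l). g (w k) l))" for w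
  have "det (mat d d (\<lambda>(k, l). \<Sum>a<n. f k a * g a l)) =
        (\<Sum>p\<in>?Perm. of_int (sign p) * (\<Prod>k = 0..<d. \<Sum>a<n. f k a * g a (p k)))"
    by (subst det_def'[of _ d]) (auto simp: permutes_in_image intro!: sum.cong prod.cong)
  also have "\<dots> = (\<Sum>p\<in>?Perm. \<Sum>w\<in>?PiE. of_int (sign p) * (\<Prod>k = 0..<d. f k (w k) * g (w k) (p k)))"
    by (simp add: prod_sum_PiE sum_distrib_left)
  also have "\<dots> = (\<Sum>w\<in>?PiE. \<Sum>p\<in>?Perm. of_int (sign p) * (\<Prod>k = 0..<d. f k (w k) * g (w k) (p k)))"
    by (rule sum.swap)
  also have "\<dots> = (\<Sum>w\<in>?PiE. F w)"
  proof (intro sum.cong refl)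
    fix w
    have "det (mat d d (\<lambda>(k, l). g (w k) l)) = (\<Sum>p\<in>?Perm. of_int (sign p) * (\<Prod>k = 0..<d. g (w k) (p k)))"
      by (subst det_def'[of _ d]) (auto simp: permutes_in_image intro!: sum.cong prod.cong)
    then show "(\<Sum>p\<in>?Perm. of_int (sign p) * (\<Prod>k = 0..<d. f k (w k) * g (w k) (p k))) = F w"
      by (simp add: F_def prod.distrib sum_distrib_left mult_ac)
  qed
  also have "\<dots> = (\<Sum>w | w \<in> ?PiE \<and> inj_on w {0..<d}. F w)"
  proof (rule sum.mono_neutral_right)
    show "\<forall>w\<in>?PiE - {w \<in> ?PiE. inj_on w {0..<d}}. F w = 0"
    proof
      fix w assume "w \<in> ?PiE - {w \<in> ?PiE. inj_on w {0..<d}}"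
      then obtain i j where ij: "i < d" "j < d" "i \<noteq> j" "w i = w j"
        by (auto simp: inj_on_def)
      have "det (mat d d (\<lambda>(k, l). g (w k) l)) = 0"
        by (rule det_identical_rows[of _ d i j]) (use ij in \<open>auto intro!: eq_vecI\<close>)
      then show "F w = 0" by (simp add: F_def)
    qed
  qed (auto intro: finite_PiE)
  also have "\<dots> = (\<Sum>(A, p)\<in>increasing_lists d n \<times> ?Perm. F (restrict (\<lambda>k. A ! p k) {0..<d}))"
    using sum.reindex_bij_betw[OF bij_betw_increasing_lists_permutations, of F d n]
    by (simp add: case_prod_unfold)
  also have "\<dots> = (\<Sum>A\<in>increasing_lists d n. \<Sum>p\<in>?Perm. F (restrict (\<lambda>k. A ! p k) {0..<d}))"
    by (rule sum.cartesian_product[symmetric])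
  also have "\<dots> = (\<Sum>A\<in>increasing_lists d n. det (mat d d (\<lambda>(k, i). f k (A ! i))) *
                     det (mat d d (\<lambda>(i, l). g (A ! i) l)))"
  proof (intro sum.cong refl)
    fix A assume "A \<in> increasing_lists d n"
    let ?G = "mat d d (\<lambda>(i, l). g (A ! i) l)"
    have "F (restrict (\<lambda>k. A ! p k) {0..<d}) =
          of_int (sign p) * (\<Prod>k = 0..<d. f k (A ! p k)) * det ?G" if p: "p \<in> ?Perm" for p
    proof -
      have p': "p permutes {0..<d}" using p by simp
      have "mat d d (\<lambda>(k, l). g (restrict (\<lambda>k. A ! p k) {0..<d} k) l) = mat d d (\<lambda>(k, l). ?G $$ (p k, l))"
        using permutes_in_image[OF p'] by (intro eq_matI) auto
      then show ?thesis
        using det_permute_rows[OF _ p', of ?G] by (simp add: F_def)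
    qed
    moreover have "det (mat d d (\<lambda>(k, i). f k (A ! i))) =
        (\<Sum>p\<in>?Perm. of_int (sign p) * (\<Prod>k = 0..<d. f k (A ! p k)))"
      by (subst det_def'[of _ d]) (auto simp: permutes_in_image intro!: sum.cong prod.cong)
    ultimately show "(\<Sum>p\<in>?Perm. F (restrict (\<lambda>k. A ! p k) {0..<d})) =
        det (mat d d (\<lambda>(k, i). f k (A ! i))) * det ?G"
      by (simp add: sum_distrib_right)
  qed
  finally show ?thesis .
qed

subsection \<open>Complete homogeneous symmetric polynomials\<close>

text \<open>For the full index set this is E(-t). The set is a parameter because one variable is
  left out in the bialternant argument.\<close>

definition linear_prod :: "'a::comm_ring_1 list \<Rightarrow> nat set \<Rightarrow> 'a fps" where
  "linear_prod xs S = (\<Prod>i\<in>S. 1 - fps_const (xs ! i) * fps_X)"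

lemma fps_nth_linear_mult:
  "fps_nth ((1 - fps_const x * fps_X) * f) k = fps_nth f k - (if k = 0 then 0 else x * fps_nth f (k - 1))"
  for f :: "'a::comm_ring_1 fps"
  by (simp add: left_diff_distrib mult.assoc)

lemma linear_prod_nth_0: "fps_nth (linear_prod xs S) 0 = 1"
  unfolding linear_prod_def
  by (induction S rule: infinite_finite_induct) (auto simp: fps_nth_linear_mult)

lemma linear_prod_nth_large:
  assumes "finite S" "card S < k"
  shows "fps_nth (linear_prod xs S) k = 0"
  using assms unfolding linear_prod_def
proof (induction S arbitrary: k rule: finite_induct)
  case (insert i S)
  then show ?case by (simp add: fps_nth_linear_mult)
qed simp

lemma geometric_fps: "(1 - fps_const x * fps_X) * Abs_fps (\<lambda>k. x ^ k) = (1 :: 'a::comm_ring_1 fps)"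
  by (rule fps_ext) (auto simp: fps_nth_linear_mult simp flip: power_Suc)

lemma finite_exponents: "finite {m. length m = l \<and> sum_list m = (k :: nat)}"
proof (rule finite_subset)
  show "{m. length m = l \<and> sum_list m = k} \<subseteq> {m. set m \<subseteq> {..k} \<and> length m = l}"
    using member_le_sum_list by auto
qed (rule finite_lists_length_eq, simp)

lemma complete_hom_Cons:
  "complete_hom (x # xs) (int k) = (\<Sum>a\<le>k. x ^ a * complete_hom xs (int (k - a)))"
proof -
  let ?M = "\<lambda>l k. {m. length m = l \<and> sum_list m = (k :: nat)}"
  let ?f = "\<lambda>m. \<Prod>i<length xs. xs ! i ^ (m ! i)"
  have "(\<Sum>a\<le>k. x ^ a * complete_hom xs (int (k - a))) = (\<Sum>a\<le>k. \<Sum>m\<in>?M (length xs) (k - a). x ^ a * ?f m)"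
    by (simp add: complete_hom_def sum_distrib_left nat_diff_distrib')
  also have "\<dots> = (\<Sum>(a, m)\<in>Sigma {..k} (\<lambda>a. ?M (length xs) (k - a)). x ^ a * ?f m)"
    by (rule sum.Sigma) (auto intro: finite_exponents)
  also have "\<dots> = (\<Sum>m\<in>?M (length (x # xs)) k. \<Prod>i<length (x # xs). (x # xs) ! i ^ (m ! i))"
    by (rule sum.reindex_bij_witness[of _ "\<lambda>m. (hd m, tl m)" "\<lambda>(a, m). a # m"])
       (auto simp: prod.lessThan_Suc_shift length_Suc_conv simp del: prod.lessThan_Suc)
  finally show ?thesis by (simp add: complete_hom_def)
qed

lemma linear_prod_Cons: "linear_prod (x # xs) {..<length (x # xs)} =
    (1 - fps_const x * fps_X) * linear_prod xs {..<length xs}"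
  by (simp add: linear_prod_def prod.lessThan_Suc_shift del: prod.lessThan_Suc)

text \<open>Splitting off the exponent of the first variable x multiplies the series by 1 / (1 - x
  t).\<close>

lemma complete_hom_fps:
  "linear_prod xs {..<length xs} * Abs_fps (\<lambda>k. complete_hom xs (int k)) = 1"
proof (induction xs)
  case Nil
  have "Abs_fps (\<lambda>k. complete_hom ([] :: 'a list) (int k)) = 1"
  proof (rule fps_ext)
    fix k :: nat
    have "{m. length m = 0 \<and> sum_list m = k} = (if k = 0 then {[]} else {})" by auto
    then show "fps_nth (Abs_fps (\<lambda>k. complete_hom ([] :: 'a list) (int k))) k = fps_nth 1 k"
      by (simp add: complete_hom_def)
  qed
  then show ?case by (simp add: linear_prod_def)
next
  case (Cons x xs)
  have "Abs_fps (\<lambda>k. complete_hom (x # xs) (int k)) =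
        Abs_fps (\<lambda>k. x ^ k) * Abs_fps (\<lambda>k. complete_hom xs (int k))"
    by (rule fps_ext) (simp add: complete_hom_Cons fps_mult_nth atLeast0AtMost)
  then have "linear_prod (x # xs) {..<length (x # xs)} * Abs_fps (\<lambda>k. complete_hom (x # xs) (int k)) =
      ((1 - fps_const x * fps_X) * Abs_fps (\<lambda>k. x ^ k)) *
      (linear_prod xs {..<length xs} * Abs_fps (\<lambda>k. complete_hom xs (int k)))"
    unfolding linear_prod_Cons by (simp only: mult_ac)
  then show ?case by (simp only: geometric_fps Cons.IH mult_1)
qed

definition elementary_sym :: "'a::comm_ring_1 list \<Rightarrow> int \<Rightarrow> 'a" where
  "elementary_sym xs k =
     (if k < 0 then 0 else (- 1) ^ nat k * fps_nth (linear_prod xs {..<length xs}) (nat k))"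

lemma eh_pair_fin_sym:
  "eh_pair_fin (elementary_sym xs) (complete_hom (xs :: 'a::idom list)) (length xs)"
proof -
  have "eh_pair (elementary_sym xs) (\<lambda>k. if k < 0 then 0
      else fps_nth (Abs_fps (\<lambda>k. complete_hom xs (int k))) (nat k))"
    unfolding elementary_sym_def[abs_def]
    by (rule eh_pair_fps[OF complete_hom_fps linear_prod_nth_0])
  also have "(\<lambda>k. if k < 0 then 0 else fps_nth (Abs_fps (\<lambda>k. complete_hom xs (int k))) (nat k)) = complete_hom xs"
    by (auto simp: fun_eq_iff complete_hom_def)
  finally interpret eh_pair "elementary_sym xs" "complete_hom xs" .
  show ?thesis
    by unfold_locales (auto simp: elementary_sym_def linear_prod_nth_large)
qed

subsection \<open>Alternants\<close>

definition alternant :: "(nat \<Rightarrow> nat) \<Rightarrow> 'a::comm_ring_1 list \<Rightarrow> 'a" where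
  "alternant b xs = det (mat (length xs) (length xs) (\<lambda>(k, i). xs ! i ^ b k))"

definition staircase :: "nat \<Rightarrow> nat list \<Rightarrow> nat \<Rightarrow> nat" where
  "staircase d la i = la ! i + (d - Suc i)"

context
  fixes xs :: "'a::idom list" and d :: nat
  assumes len: "length xs = d"
begin

interpretation eh_pair_fin "elementary_sym xs" "complete_hom xs" d
  using eh_pair_fin_sym[of xs] by (simp add: len)

lemma schur_eq_hdet: "schur la xs = hdet (staircase d la)"
proof -
  have "mat d d (\<lambda>(i, j). complete_hom xs (int (la ! i) + int j - int i)) =
    mat d d (\<lambda>(i, j). complete_hom xs (int (staircase d la i) + int j + 1 - int d))"
  proof (rule eq_matI, goal_cases)
    case (1 i j)
    then have "int (la ! i) + int j - int i = int (staircase d la i) + int j + 1 - int d"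
      by (auto simp: staircase_def)
    with 1 show ?case by (simp only: index_mat dim_row_mat dim_col_mat prod.case)
  qed auto
  then show ?thesis by (simp add: schur_def hdet_def len)
qed

text \<open>The series 1 / (1 - x_i t) equals H(t) times the product of the other factors 1 - x_l t.
  That product has degree at most d - 1, so x_i^b combines d consecutive h's with coefficients
  independent of b.\<close>

lemma power_eq_sum_complete_hom:
  assumes "i < d"
  shows "xs ! i ^ b = (\<Sum>j<d. complete_hom xs (int b + int j + 1 - int d) *
            fps_nth (linear_prod xs ({..<d} - {i})) (d - Suc j))"
proof -
  let ?W = "linear_prod xs ({..<d} - {i})"
  let ?H = "Abs_fps (\<lambda>k. complete_hom xs (int k))"
  let ?G = "Abs_fps (\<lambda>k. xs ! i ^ k)"
  have W: "linear_prod xs {..<d} = (1 - fps_const (xs ! i) * fps_X) * ?W"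
    unfolding linear_prod_def using assms by (subst prod.remove[of _ i]) auto
  have "?G = ?G * (linear_prod xs {..<d} * ?H)"
    using complete_hom_fps[of xs] by (simp add: len)
  also have "\<dots> = ((1 - fps_const (xs ! i) * fps_X) * ?G) * (?W * ?H)"
    unfolding W by (simp only: mult_ac)
  finally have "?G = ?W * ?H" by (simp only: geometric_fps mult_1)
  then have "xs ! i ^ b = fps_nth (?W * ?H) b" by (metis fps_nth_Abs_fps)
  also have "\<dots> = (\<Sum>m\<le>b. fps_nth ?W m * complete_hom xs (int b - int m))"
    by (simp add: fps_mult_nth atLeast0AtMost of_nat_diff)
  also have "\<dots> = (\<Sum>m\<le>max b d. fps_nth ?W m * complete_hom xs (int b - int m))"
    by (rule sum.mono_neutral_left) (auto simp: h_neg)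
  also have "\<dots> = (\<Sum>m<d. fps_nth ?W m * complete_hom xs (int b - int m))"
    using assms by (intro sum.mono_neutral_right) (auto simp: linear_prod_nth_large)
  also have "\<dots> = (\<Sum>j<d. complete_hom xs (int b + int j + 1 - int d) * fps_nth ?W (d - Suc j))"
    by (rule sum.reindex_bij_witness[of _ "\<lambda>j. d - Suc j" "\<lambda>m. d - Suc m"])
       (auto simp: of_nat_diff algebra_simps)
  finally show ?thesis .
qed

text \<open>The alternant matrix factors into the h-matrix and a matrix that does not involve b.
  Hence a quotient of two alternants is a quotient of h-determinants, and the staircase has
  h-determinant 1.\<close>

lemma alternant_eq_hdet_mult:
  "alternant b xs = hdet b * det (mat d d (\<lambda>(j, i). fps_nth (linear_prod xs ({..<d} - {i})) (d - Suc j)))"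
proof -
  let ?H = "mat d d (\<lambda>(k, j). complete_hom xs (int (b k) + int j + 1 - int d))"
  let ?W = "mat d d (\<lambda>(j, i). fps_nth (linear_prod xs ({..<d} - {i})) (d - Suc j))"
  have "mat d d (\<lambda>(k, i). xs ! i ^ b k) = ?H * ?W"
    by (rule eq_matI) (auto simp: scalar_prod_def power_eq_sum_complete_hom atLeast0LessThan)
  then show ?thesis
    by (simp add: alternant_def len hdet_def det_mult[of _ d])
qed

lemma alternant_base_eq:
  "alternant (\<lambda>k. d - Suc k) xs = det (mat d d (\<lambda>(j, i). fps_nth (linear_prod xs ({..<d} - {i})) (d - Suc j)))"
  by (simp add: alternant_eq_hdet_mult hdet_base)

lemma bialternant: "schur la xs * alternant (\<lambda>k. d - Suc k) xs = alternant (staircase d la) xs"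
  by (simp add: alternant_eq_hdet_mult[of "staircase d la"] alternant_base_eq schur_eq_hdet)

text \<open>With \<open>x\<^sub>i ^ n = \<epsilon>\<close> for all \<open>i\<close>, the vectors \<open>h (n - d + 1), \<dots>, h n\<close> and
  \<open>\<epsilon> h (1 - d), \<dots>, \<epsilon> h 0\<close> have the same product with an invertible matrix.\<close>

lemma complete_hom_roots:
  assumes eps: "\<And>i. i < d \<Longrightarrow> xs ! i ^ n = eps"
    and nz: "alternant (\<lambda>k. d - Suc k) xs \<noteq> 0"
    and k: "n < k + d" "k \<le> n"
  shows "complete_hom xs (int k) = (if k = n then eps else 0)"
proof -
  define v where "v j = complete_hom xs (int n + int j + 1 - int d) -
                    eps * complete_hom xs (int 0 + int j + 1 - int d)" for j
  let ?W = "mat d d (\<lambda>(i, j). fps_nth (linear_prod xs ({..<d} - {i})) (d - Suc j))"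
  have det: "det ?W \<noteq> 0"
    using nz unfolding alternant_base_eq
    by (subst det_mat_transpose) simp
  have "?W *\<^sub>v vec d v = 0\<^sub>v d"
  proof (rule eq_vecI)
    fix i assume "i < dim_vec (0\<^sub>v d)"
    then have i: "i < d" by simp
    have "(\<Sum>j<d. fps_nth (linear_prod xs ({..<d} - {i})) (d - Suc j) * v j) = xs ! i ^ n - eps * xs ! i ^ 0"
      unfolding power_eq_sum_complete_hom[OF i] v_def
      by (simp add: sum_distrib_left algebra_simps flip: sum_subtractf)
    then show "(?W *\<^sub>v vec d v) $ i = 0\<^sub>v d $ i"
      using i eps[OF i] by (simp add: scalar_prod_def atLeast0LessThan)
  qed auto
  then have "vec d v = 0\<^sub>v d"
    using det det_0_iff_vec_prod_zero[of ?W d] by (metis mat_carrier vec_carrier)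
  then have v: "v j = 0" if "j < d" for j
    using that by (metis index_vec index_zero_vec(1))
  define j where "j = k + d - Suc n"
  have j: "j < d" "int n + int j + 1 - int d = int k" "int 0 + int j + 1 - int d = int k - int n"
    using k by (auto simp: j_def)
  have "complete_hom xs (int k) = eps * complete_hom xs (int k - int n)"
    using v[OF j(1)] unfolding v_def j(2,3) by simp
  then show ?thesis
    using k by (auto simp: h_0 h_neg)
qed

end

lemma alternant_scale:
  "alternant b (map ((*) t) xs) = t ^ (\<Sum>k<length xs. b k) * alternant b xs"
proof -
  have "alternant b (map ((*) t) xs) =
      det (mat (length xs) (length xs) (\<lambda>(k, i). t ^ b k * 1 * xs ! i ^ b k))"
    unfolding alternant_def by (rule arg_cong[of _ _ det]) (auto simp: power_mult_distrib intro!: eq_matI)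
  then show ?thesis
    unfolding det_scale_rows_cols by (simp add: alternant_def power_sum)
qed

text \<open>The rows are those of the Vandermonde matrix in reverse order. The sign is left open,
  since only nonvanishing and the absolute value are used.\<close>

lemma alternant_base_vandermonde:
  fixes xs :: "'a::idom list"
  assumes "length xs = d"
  shows "alternant (\<lambda>k. d - Suc k) xs \<in> {\<Prod>j<d. \<Prod>i<j. xs ! j - xs ! i, - (\<Prod>j<d. \<Prod>i<j. xs ! j - xs ! i)}"
proof -
  define p where "p k = (if k < d then d - Suc k else k)" for k
  have p: "p permutes {0..<d}"
  proof (rule bij_imp_permutes)
    show "bij_betw p {0..<d} {0..<d}"
      by (rule bij_betwI[of _ _ _ p]) (auto simp: p_def)
  qed (auto simp: p_def)
  let ?V = "mat d d (\<lambda>(k, i). xs ! i ^ k)"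
  have "mat d d (\<lambda>(k, i). xs ! i ^ (d - Suc k)) = mat d d (\<lambda>(k, i). ?V $$ (p k, i))"
    by (rule eq_matI) (auto simp: p_def)
  then have "alternant (\<lambda>k. d - Suc k) xs = of_int (sign p) * det ?V"
    using det_permute_rows[OF _ p, of ?V] by (simp add: alternant_def assms)
  also have "det ?V = (\<Prod>j<d. \<Prod>i<j. xs ! j - xs ! i)"
    by (subst det_mat_transpose) (rule det_vandermonde)
  finally show ?thesis by (auto simp: sign_def)
qed

lemma alternant_base_nonzero:
  fixes xs :: "'a::idom list"
  assumes "length xs = d" "distinct xs"
  shows "alternant (\<lambda>k. d - Suc k) xs \<noteq> 0"
proof -
  have "(\<Prod>j<d. \<Prod>i<j. xs ! j - xs ! i) \<noteq> 0"
    using assms by (auto simp: nth_eq_iff_index_eq)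
  then show ?thesis
    using alternant_base_vandermonde[OF assms(1)] by auto
qed

lemma cmod_alternant_base: "length xs = d \<Longrightarrow> cmod (alternant (\<lambda>k. d - Suc k) xs) = abs_vand xs"
  using alternant_base_vandermonde[of xs d]
  by (auto simp: abs_vand_def prod_norm[symmetric] norm_minus_commute)

text \<open>Homogeneity is read off the quotient of alternants; distinct entries and a nonzero t
  make the denominator cancellable.\<close>

lemma schur_scale:
  fixes xs :: "'a::field list"
  assumes "length xs = d" "distinct xs" "length la = d" "t \<noteq> 0"
  shows "schur la (map ((*) t) xs) = t ^ sum_list la * schur la xs"
proof -
  let ?base = "\<lambda>k. d - Suc k"
  have base: "alternant ?base (map ((*) t) xs) \<noteq> 0"
    using assms by (intro alternant_base_nonzero) (auto simp: distinct_map inj_on_def)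
  have "sum_list la = (\<Sum>k<d. la ! k)"
    using assms by (simp add: sum_list_sum_nth atLeast0LessThan)
  then have "(\<Sum>k<d. staircase d la k) = sum_list la + (\<Sum>k<d. ?base k)"
    unfolding staircase_def by (simp only: sum.distrib)
  then have "schur la (map ((*) t) xs) * alternant ?base (map ((*) t) xs) =
        t ^ (sum_list la + (\<Sum>k<d. ?base k)) * (schur la xs * alternant ?base xs)"
    using bialternant[of "map ((*) t) xs" d la] bialternant[of xs d la] assms
    by (simp only: alternant_scale length_map)
  also have "\<dots> = (t ^ sum_list la * schur la xs) * alternant ?base (map ((*) t) xs)"
    using assms by (simp add: alternant_scale power_add)
  finally show ?thesis using base by simp
qed

subsection \<open>Roots of unity\<close>

text \<open>The smallest admissible index in I_(d,n) is -(d-1)/2; counting from it replaces integers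
  or half-integers by 0, ..., n - 1.\<close>

definition shifted_root :: "nat \<Rightarrow> nat \<Rightarrow> nat \<Rightarrow> complex" where
  "shifted_root d n a = zeta_pow n (real a - (real d - 1) / 2)"

lemma zeta_pow_eq_cis: "zeta_pow n r = cis (2 * pi * r / real n)"
  by (simp add: zeta_pow_def cis_conv_exp mult_ac)

lemma norm_shifted_root: "cmod (shifted_root d n a) = 1"
  by (simp add: shifted_root_def zeta_pow_eq_cis)

lemma shifted_root_eq: "shifted_root d n a = shifted_root d n 0 * cis (2 * pi / real n) ^ a"
  by (simp add: shifted_root_def zeta_pow_eq_cis DeMoivre cis_mult)
     (simp add: algebra_simps add_divide_distrib diff_divide_distrib)

lemma inj_on_cis_power: "inj_on (\<lambda>a. cis (2 * pi / real n) ^ a) {..<n}"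
proof (cases "n = 0")
  case False
  then have "inj_on (\<lambda>k. cis (2 * pi * real k / real n)) {..<n}"
    using bij_betw_roots_unity[of n] by (auto simp: bij_betw_def)
  then show ?thesis by (simp add: DeMoivre mult_ac)
qed simp

lemma inj_on_shifted_root: "inj_on (shifted_root d n) {..<n}"
proof (rule inj_onI)
  fix a b assume ab: "a \<in> {..<n}" "b \<in> {..<n}" and eq: "shifted_root d n a = shifted_root d n b"
  have "shifted_root d n 0 \<noteq> 0"
    using norm_shifted_root[of d n 0] by auto
  then show "a = b"
    using eq inj_onD[OF inj_on_cis_power _ ab] by (simp add: shifted_root_eq[of d n a] shifted_root_eq[of d n b])
qed

text \<open>Only the shift contributes, with the angle -(d-1) pi; written as d (-pi) + pi it becomes
  the sign (-1)^(d+1).\<close>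

lemma shifted_root_power:
  assumes "n > 0"
  shows "shifted_root d n a ^ n = (- 1) ^ (d + 1)"
proof -
  have "real n * (2 * pi * (real a - (real d - 1) / 2) / real n) = 2 * pi * real a + real d * (- pi) + pi"
    using assms by (simp add: field_simps)
  then have "shifted_root d n a ^ n = cis (2 * pi * real a + real d * (- pi) + pi)"
    by (simp only: shifted_root_def zeta_pow_eq_cis DeMoivre)
  also have "\<dots> = cis (2 * pi * real a) * cis (- pi) ^ d * cis pi"
    by (simp only: cis_mult DeMoivre)
  also have "\<dots> = (- 1) ^ (d + 1)"
  proof -
    have "cis (2 * pi * real a) = cis (2 * pi) ^ a" by (simp add: DeMoivre mult_ac)
    moreover have "cis (- pi) = - 1" by (simp add: complex_eq_iff)
    ultimately show ?thesis by simp
  qed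
  finally show ?thesis .
qed

text \<open>The shift contributes a factor independent of a. What remains is a geometric sum whose
  ratio r satisfies r^n = 1 and, as p and q are distinct and below n, r is not 1.\<close>

lemma sum_shifted_root:
  assumes "p < n" "q < n"
  shows "(\<Sum>a<n. shifted_root d n a ^ p * cnj (shifted_root d n a) ^ q) = (if p = q then of_nat n else 0)"
proof (cases "p = q")
  case True
  have "shifted_root d n a * cnj (shifted_root d n a) = 1" for a
    by (simp add: complex_norm_square[symmetric] norm_shifted_root)
  then show ?thesis using True by (simp flip: power_mult_distrib)
next
  case False
  define w z where "w = shifted_root d n 0" and "z = cis (2 * pi / real n)"
  define r where "r = z ^ p * cnj z ^ q"
  have z: "z * cnj z = 1"
    by (simp add: complex_norm_square[symmetric] z_def)
  have zn: "z ^ n = 1"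
    using assms by (simp add: z_def DeMoivre)
  have "r \<noteq> 1"
  proof
    assume "r = 1"
    then have "z ^ p * (z * cnj z) ^ q = z ^ q"
      by (simp add: r_def power_mult_distrib mult_ac)
    then have "z ^ p = z ^ q" using z by simp
    then show False
      using inj_onD[OF inj_on_cis_power, of n p q] assms False by (simp add: z_def)
  qed
  have "cnj z ^ n = 1"
    using zn by (metis complex_cnj_one complex_cnj_power)
  then have "r ^ n = 1"
    using zn by (simp add: r_def power_mult_distrib mult.commute flip: power_mult)
       (simp add: power_mult)
  then have "(1 - r) * (\<Sum>a<n. r ^ a) = 0"
    by (simp flip: one_diff_power_eq)
  then have r0: "(\<Sum>a<n. r ^ a) = 0"
    using \<open>r \<noteq> 1\<close> by simp
  have "shifted_root d n a ^ p * cnj (shifted_root d n a) ^ q = w ^ p * cnj w ^ q * r ^ a" for a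
    unfolding shifted_root_eq[of d n a] w_def[symmetric] z_def[symmetric] r_def
    by (simp add: power_mult_distrib mult_ac flip: power_mult)
  then show ?thesis
    using False r0 by (simp flip: sum_distrib_left)
qed

text \<open>In both parities of d, adding (d-1)/2 turns the admissible entries into the integers 0,
  ..., n - 1.\<close>

lemma bij_betw_root_index:
  assumes "1 \<le> d"
  shows "bij_betw (map (\<lambda>a. real a - (real d - 1) / 2)) (increasing_lists d n) (root_index d n)"
proof (rule bij_betwI[where g = "map (\<lambda>j. nat \<lfloor>j + (real d - 1) / 2\<rfloor>)"])
  let ?f = "\<lambda>a. real a - (real d - 1) / 2" and ?g = "\<lambda>j. nat \<lfloor>j + (real d - 1) / 2\<rfloor>"
  show "map ?f \<in> increasing_lists d n \<rightarrow> root_index d n"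
  proof
    fix A assume A: "A \<in> increasing_lists d n"
    have bounds: "- (real d - 1) / 2 \<le> ?f a \<and> ?f a \<le> real n - (real d + 1) / 2" if "a \<in> set A" for a
    proof -
      have "a < n" using that A by (auto simp: increasing_lists_def)
      then have "real a + 1 \<le> real n" by linarith
      then show ?thesis by (simp add: field_simps)
    qed
    have "?f a \<in> \<int>" if "odd d" for a
    proof -
      obtain m where "d = 2 * m + 1" using \<open>odd d\<close> by (rule oddE)
      then show ?thesis by (simp add: Ints_diff)
    qed
    moreover have "?f a - 1 / 2 \<in> \<int>" if "even d" for a
    proof -
      obtain m where "d = 2 * m" using \<open>even d\<close> by (rule evenE)
      then have eq: "?f a - 1 / 2 = real a - real m" by (simp add: field_simps)
      show ?thesis unfolding eq by (intro Ints_diff Ints_of_nat)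
    qed
    moreover have "sorted_wrt (<) (map ?f A)"
      using A by (simp add: increasing_lists_def sorted_wrt_map)
    ultimately show "map ?f A \<in> root_index d n"
      using A bounds by (auto simp: root_index_def increasing_lists_def)
  qed
  have int: "real (?g j) = j + (real d - 1) / 2" "?g j < n"
    if J: "J \<in> root_index d n" and j: "j \<in> set J" for J j
  proof -
    have bounds: "- (real d - 1) / 2 \<le> j" "j \<le> real n - (real d + 1) / 2"
      using J j by (auto simp: root_index_def)
    have "j + (real d - 1) / 2 \<in> \<int>"
    proof (cases "odd d")
      case True
      then obtain m where m: "d = 2 * m + 1" by (rule oddE)
      have "j \<in> \<int>" using J j True by (auto simp: root_index_def)
      then show ?thesis using m by simp
    next
      case False
      then obtain m where m: "d = 2 * m" by (auto elim: evenE)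
      have "j - 1 / 2 \<in> \<int>" using J j False by (auto simp: root_index_def)
      then have "(j - 1 / 2) + real m \<in> \<int>" by (intro Ints_add) auto
      then show ?thesis using m by (simp add: field_simps)
    qed
    moreover have "0 \<le> j + (real d - 1) / 2" "j + (real d - 1) / 2 \<le> real n - 1"
      using bounds by (simp_all add: field_simps)
    ultimately show eq: "real (?g j) = j + (real d - 1) / 2"
      by (auto elim!: Ints_cases)
    then show "?g j < n"
      using \<open>j + (real d - 1) / 2 \<le> real n - 1\<close> by linarith
  qed
  show "map ?g \<in> root_index d n \<rightarrow> increasing_lists d n"
  proof
    fix J assume J: "J \<in> root_index d n"
    have "sorted_wrt (\<lambda>i j. ?g i < ?g j) J"
    proof (rule sorted_wrt_mono_rel)
      show "sorted_wrt (<) J" using J by (simp add: root_index_def)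
      fix i j assume "i \<in> set J" "j \<in> set J" "i < j"
      then have "real (?g i) < real (?g j)" using int(1)[OF J] by simp
      then show "?g i < ?g j" by simp
    qed
    then show "map ?g J \<in> increasing_lists d n"
      using J int(2)[OF J] by (auto simp: increasing_lists_def sorted_wrt_map root_index_def)
  qed
  show "map ?g (map ?f A) = A" for A
    by (simp add: o_def map_idI)
  show "map ?f (map ?g J) = J" if "J \<in> root_index d n" for J
    using int(1)[OF that] by (simp add: o_def map_idI)
qed

lemma zeta_tuple_eq: "zeta_tuple n (map (\<lambda>a. real a - (real d - 1) / 2) A) = map (shifted_root d n) A"
  by (simp add: zeta_tuple_def shifted_root_def o_def)

lemma distinct_map_shifted_root:
  assumes "A \<in> increasing_lists d n"
  shows "distinct (map (shifted_root d n) A)"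
  using assms inj_on_subset[OF inj_on_shifted_root]
  by (auto simp: distinct_map increasing_lists_def strict_sorted_iff)

subsection \<open>Orthogonality\<close>

lemma comm_ring_hom_cnj: "comm_ring_hom cnj"
  by unfold_locales auto

lemma cnj_alternant: "cnj (alternant b xs) = alternant b (map cnj xs)"
proof -
  interpret comm_ring_hom cnj by (rule comm_ring_hom_cnj)
  let ?A = "mat (length xs) (length xs) (\<lambda>(k, i). xs ! i ^ b k)"
  have "map_mat cnj ?A = mat (length xs) (length xs) (\<lambda>(k, i). map cnj xs ! i ^ b k)"
    by (rule eq_matI) auto
  then show ?thesis
    using hom_det[of ?A] by (simp add: alternant_def)
qed

lemma strict_decreasing_eq:
  fixes b g :: "nat \<Rightarrow> nat"
  assumes b: "\<And>i j. i < j \<Longrightarrow> j < d \<Longrightarrow> b j < b i" and g: "\<And>i j. i < j \<Longrightarrow> j < d \<Longrightarrow> g j < g i"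
    and sub: "b ` {..<d} \<subseteq> g ` {..<d}" and "k < d"
  shows "b k = g k"
proof -
  have inj: "inj_on f {..<d}" if "\<And>i j. i < j \<Longrightarrow> j < d \<Longrightarrow> f j < f i" for f :: "nat \<Rightarrow> nat"
    by (rule linorder_inj_onI) (use that in force)+
  have eq: "b ` {..<d} = g ` {..<d}"
    using inj[OF b] inj[OF g] sub by (intro card_subset_eq) (auto simp: card_image)
  have sorted: "sorted_wrt (<) (rev (map f [0..<d]))" if "\<And>i j. i < j \<Longrightarrow> j < d \<Longrightarrow> f j < f i" for f :: "nat \<Rightarrow> nat"
    using that by (simp only: sorted_wrt_rev) (auto simp: sorted_wrt_iff_nth_less)
  have "rev (map b [0..<d]) = rev (map g [0..<d])"
  proof (rule sorted_distinct_set_unique)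
    show "set (rev (map b [0..<d])) = set (rev (map g [0..<d]))"
      using eq by (simp add: atLeast0LessThan)
  qed (use sorted[of b, OF b] sorted[of g, OF g] in \<open>auto simp: strict_sorted_iff\<close>)
  then show ?thesis using \<open>k < d\<close> by simp
qed

text \<open>Read backwards, Cauchy-Binet turns the sum over A into the determinant of the matrix
  with entry n where b k = g l and 0 elsewhere. For b = g this is n times the identity; otherwise
  some value of b is missed by g and gives a zero row.\<close>

theorem alternants_orthogonal:
  assumes b: "\<And>i j. i < j \<Longrightarrow> j < d \<Longrightarrow> b j < b i" and g: "\<And>i j. i < j \<Longrightarrow> j < d \<Longrightarrow> g j < g i"
    and less: "\<And>i. i < d \<Longrightarrow> b i < n" "\<And>i. i < d \<Longrightarrow> g i < n"
  shows "(\<Sum>A\<in>increasing_lists d n. alternant b (map (shifted_root d n) A) *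
            cnj (alternant g (map (shifted_root d n) A))) =
         (if \<forall>k<d. b k = g k then of_nat n ^ d else 0)"
proof -
  let ?w = "shifted_root d n"
  let ?M = "mat d d (\<lambda>(k, l). if b k = g l then of_nat n else 0 :: complex)"
  have "alternant b (map ?w A) * cnj (alternant g (map ?w A)) =
      det (mat d d (\<lambda>(k, i). ?w (A ! i) ^ b k)) * det (mat d d (\<lambda>(i, l). cnj (?w (A ! i)) ^ g l))"
    if A: "A \<in> increasing_lists d n" for A
  proof -
    have len: "length A = d" using A by (simp add: increasing_lists_def)
    have "alternant b (map ?w A) = det (mat d d (\<lambda>(k, i). ?w (A ! i) ^ b k))"
      unfolding alternant_def by (rule arg_cong[of _ _ det]) (auto simp: len intro!: eq_matI)
    moreover have "cnj (alternant g (map ?w A)) = det (mat d d (\<lambda>(l, i). cnj (?w (A ! i)) ^ g l))"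
      unfolding cnj_alternant unfolding alternant_def by (rule arg_cong[of _ _ det]) (auto simp: len intro!: eq_matI)
    moreover have "\<dots> = det (mat d d (\<lambda>(i, l). cnj (?w (A ! i)) ^ g l))"
      by (rule det_mat_transpose)
    ultimately show ?thesis by simp
  qed
  then have "(\<Sum>A\<in>increasing_lists d n. alternant b (map ?w A) * cnj (alternant g (map ?w A))) =
      det (mat d d (\<lambda>(k, l). \<Sum>a<n. ?w a ^ b k * cnj (?w a) ^ g l))"
    by (simp add: cauchy_binet)
  also have "mat d d (\<lambda>(k, l). \<Sum>a<n. ?w a ^ b k * cnj (?w a) ^ g l) = ?M"
    using less by (intro eq_matI) (auto simp: sum_shifted_root)
  also have "det ?M = (if \<forall>k<d. b k = g k then of_nat n ^ d else 0)"
  proof (cases "\<forall>k<d. b k = g k")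
    case True
    have "b k = b l \<longleftrightarrow> k = l" if "k < d" "l < d" for k l
      using b[of k l] b[of l k] that by (cases k l rule: linorder_cases) auto
    then have "?M = of_nat n \<cdot>\<^sub>m 1\<^sub>m d"
      using True by (intro eq_matI) auto
    then show ?thesis using True by simp
  next
    case False
    then have "\<not> b ` {..<d} \<subseteq> g ` {..<d}"
      using strict_decreasing_eq[of d b g, OF b g] by blast
    then obtain k where k: "k < d" "\<And>l. l < d \<Longrightarrow> b k \<noteq> g l" by auto
    have "(\<Prod>i = 0..<d. ?M $$ (i, p i)) = 0" if "p permutes {0..<d}" for p
      using k permutes_in_image[OF that, of k] by (intro prod_zero bexI[of _ k]) auto
    then have "det ?M = 0"
      by (subst det_def'[of _ d]) (auto intro!: sum.neutral)
    then show ?thesis by (simp only: if_not_P[OF False])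
  qed
  finally show ?thesis .
qed

subsection \<open>Evaluation at roots of unity and the structure constants\<close>

lemma Sh_nth_mono: "la \<in> Sh d c \<Longrightarrow> i \<le> j \<Longrightarrow> j < d \<Longrightarrow> la ! j \<le> la ! i"
  by (cases "i = j") (auto simp: Sh_def sorted_wrt_iff_nth_less)

lemma Sh_nth_le: "la \<in> Sh d c \<Longrightarrow> i < d \<Longrightarrow> la ! i \<le> c"
  by (auto simp: Sh_def subset_iff)

lemma staircase_decreasing: "la \<in> Sh d c \<Longrightarrow> i < j \<Longrightarrow> j < d \<Longrightarrow> staircase d la j < staircase d la i"
  using Sh_nth_mono[of la d c i j] by (simp add: staircase_def)

lemma staircase_less: "la \<in> Sh d (n - d) \<Longrightarrow> d \<le> n \<Longrightarrow> i < d \<Longrightarrow> staircase d la i < n"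
  using Sh_nth_le[of la d "n - d" i] by (simp add: staircase_def)

lemma staircase_eqD:
  assumes "la \<in> Sh d c" "mu \<in> Sh d c" "\<forall>k<d. staircase d la k = staircase d mu k"
  shows "la = mu"
  by (rule nth_equalityI) (use assms in \<open>auto simp: Sh_def staircase_def\<close>)

lemma sum_list_PD:
  assumes "nu \<in> Sh d c"
  shows "sum_list (PD c nu) + sum_list nu = c * d"
proof -
  have "sum_list (map (\<lambda>x. c - x) xs) + sum_list xs = c * length xs" if "set xs \<subseteq> {0..c}" for xs
    using that by (induction xs) (auto simp: algebra_simps)
  from this[of "rev nu"] show ?thesis using assms by (simp add: Sh_def PD_def rev_map)
qed

lemma staircase_PD:
  assumes "nu \<in> Sh d c" "k < d"
  shows "staircase d (PD c nu) k + staircase d nu (d - Suc k) = c + d - 1"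
  using assms Sh_nth_le[OF assms(1), of "d - Suc k"]
  by (auto simp: staircase_def PD_def rev_nth Sh_def)

text \<open>On the unit circle, conjugation replaces the exponents \<open>b\<close> of an alternant by \<open>n - 1 - b\<close>, up
  to a factor that does not depend on the partition.\<close>

lemma cnj_schur_PD:
  assumes nu: "nu \<in> Sh d c" and xs: "length xs = d" "distinct xs" "\<And>x. x \<in> set xs \<Longrightarrow> cmod x = 1"
  shows "cnj (schur (PD c nu) xs) = schur nu xs / schur (replicate d c) xs"
proof -
  define m where "m = c + d - 1"
  define p where "p k = (if k < d then d - Suc k else k)" for k
  have p: "p permutes {0..<d}"
  proof (rule bij_imp_permutes)
    show "bij_betw p {0..<d} {0..<d}"
      by (rule bij_betwI[of _ _ _ p]) (auto simp: p_def)
  qed (auto simp: p_def)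
  define w where "w = (\<Prod>i<d. xs ! i ^ m)"
  have unit: "xs ! i * cnj (xs ! i) = 1" if "i < d" for i
    using that xs by (simp add: complex_norm_square[symmetric])
  have nonzero: "xs ! i \<noteq> 0" if "i < d" for i
    using unit[OF that] by auto
  have w: "w \<noteq> 0"
    using nonzero by (simp add: w_def)
  \<comment> \<open>Column i absorbs x_i^m, which turns conj(x_i)^b into x_i^(m-b). By
    \<open>staircase_PD\<close> these are the exponents of la in reverse order, whence the sign of
    p.\<close>
  have key: "w * cnj (alternant (staircase d (PD c la)) xs) = of_int (sign p) * alternant (staircase d la) xs"
    if la: "la \<in> Sh d c" for la
  proof -
    let ?b = "staircase d (PD c la)" and ?A = "mat d d (\<lambda>(k, i). xs ! i ^ staircase d la k)"
    have "w * cnj (alternant ?b xs) =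
        (\<Prod>k<d. 1) * (\<Prod>i<d. xs ! i ^ m) * det (mat d d (\<lambda>(k, i). cnj (xs ! i) ^ ?b k))"
      unfolding cnj_alternant unfolding alternant_def w_def
      by (auto simp: xs(1) intro!: arg_cong[of _ _ det] eq_matI)
    also have "\<dots> = det (mat d d (\<lambda>(k, i). 1 * xs ! i ^ m * cnj (xs ! i) ^ ?b k))"
      by (rule det_scale_rows_cols[symmetric])
    also have "mat d d (\<lambda>(k, i). 1 * xs ! i ^ m * cnj (xs ! i) ^ ?b k) = mat d d (\<lambda>(k, i). ?A $$ (p k, i))"
    proof (rule eq_matI, goal_cases)
      case (1 k i)
      then have "m = staircase d la (d - Suc k) + ?b k"
        using staircase_PD[OF la, of k] by (simp add: m_def)
      then have "xs ! i ^ m * cnj (xs ! i) ^ ?b k =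
          xs ! i ^ staircase d la (d - Suc k) * (xs ! i * cnj (xs ! i)) ^ ?b k"
        by (simp only: power_add power_mult_distrib mult_ac)
      with 1 show ?case by (simp add: unit p_def)
    qed auto
    also have "det \<dots> = of_int (sign p) * det ?A"
      by (rule det_permute_rows[OF _ p]) simp
    finally show ?thesis by (simp add: alternant_def xs(1))
  qed
  \<comment> \<open>PD of the full rectangle is the empty partition, so this case of
    \<open>key\<close> identifies the common factor with S_(c^d) times the base alternant, up to
    sign.\<close>
  have full: "replicate d c \<in> Sh d c"
    by (auto simp: Sh_def sorted_wrt_iff_nth_less)
  have "alternant (staircase d (PD c (replicate d c))) xs = alternant (\<lambda>k. d - Suc k) xs"
    unfolding alternant_def
    by (rule arg_cong[of _ _ det]) (auto simp: PD_def staircase_def xs(1) intro!: eq_matI)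
  with key[OF full] have base: "w * cnj (alternant (\<lambda>k. d - Suc k) xs) =
      of_int (sign p) * alternant (staircase d (replicate d c)) xs"
    by simp
  have nz: "alternant (\<lambda>k. d - Suc k) xs \<noteq> 0"
    by (rule alternant_base_nonzero[OF xs(1,2)])
  have sign: "of_int (sign p) \<noteq> (0 :: complex)"
    by (simp add: sign_def)
  have "cnj (schur (PD c nu) xs) * (w * cnj (alternant (\<lambda>k. d - Suc k) xs)) =
        of_int (sign p) * (schur nu xs * alternant (\<lambda>k. d - Suc k) xs)"
    using key[OF nu] bialternant[OF xs(1), of "PD c nu", symmetric] bialternant[OF xs(1), of nu]
    by (simp add: mult_ac)
  moreover have "w * cnj (alternant (\<lambda>k. d - Suc k) xs) =
      of_int (sign p) * (schur (replicate d c) xs * alternant (\<lambda>k. d - Suc k) xs)"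
    using base bialternant[OF xs(1), of "replicate d c"] by simp
  ultimately have "cnj (schur (PD c nu) xs) * schur (replicate d c) xs = schur nu xs"
    using nz sign by simp
  moreover have "schur (replicate d c) xs \<noteq> 0"
    using base w nz bialternant[OF xs(1), of "replicate d c"] by auto
  ultimately show ?thesis by (simp add: field_simps)
qed

section \<open>Evaluation at the elementary symmetric functions of a tuple\<close>

lemma poly_eval_X_poly:
  assumes "length ys = d"
  shows "poly_eval (\<lambda>i. elementary_sym ys (int i)) (X_poly d k) = elementary_sym ys k"
proof -
  interpret eh_pair_fin "elementary_sym ys" "complete_hom ys" d
    using eh_pair_fin_sym[of ys] by (simp add: assms)
  interpret ev: comm_ring_hom "poly_eval (\<lambda>i. elementary_sym ys (int i))"
    by (rule comm_ring_hom_poly_eval)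
  show ?thesis
    using e_neg[of k] e_large[of k]
    by (auto simp: X_poly_def poly_eval_single mono_eval_def e_0)
qed

lemma poly_eval_det:
  "poly_eval x (det (mat k k f)) = det (mat k k (\<lambda>ij. poly_eval x (f ij)))"
proof -
  interpret ev: comm_ring_hom "poly_eval x" by (rule comm_ring_hom_poly_eval)
  have "map_mat (poly_eval x) (mat k k f) = mat k k (\<lambda>ij. poly_eval x (f ij))"
    by (rule eq_matI) auto
  then show ?thesis by (metis ev.hom_det)
qed

lemma poly_eval_Y_poly:
  assumes "length ys = d"
  shows "poly_eval (\<lambda>i. elementary_sym ys (int i)) (Y_poly d k) = complete_hom ys (int k)"
proof -
  interpret eh_pair_fin "elementary_sym ys" "complete_hom ys" d
    using eh_pair_fin_sym[of ys] by (simp add: assms)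
  show ?thesis
    unfolding jacobi_trudi_single_row Y_poly_def poly_eval_det
    by (simp add: case_prod_unfold poly_eval_X_poly assms)
qed

lemma poly_eval_s_poly:
  assumes "length ys = d" "la \<in> Sh d (n - d)"
  shows "poly_eval (\<lambda>i. elementary_sym ys (int i)) (s_poly d n la) = schur la ys"
proof -
  interpret eh_pair_fin "elementary_sym ys" "complete_hom ys" d
    using eh_pair_fin_sym[of ys] by (simp add: assms)
  show ?thesis
    using dual_jacobi_trudi[OF assms(2)] unfolding schur_def s_poly_def poly_eval_det
    by (simp add: case_prod_unfold poly_eval_X_poly assms)
qed

section \<open>Determination of the coefficients\<close>

context quantum begin

definition vafa_intriligator :: "nat list \<Rightarrow> nat list \<Rightarrow> nat list \<Rightarrow> complex" where
  "vafa_intriligator la mu nu = 1 / of_nat n ^ d *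
     (\<Sum>J\<in>root_index d n. schur la (zeta_tuple n J) * schur mu (zeta_tuple n J) *
        schur nu (zeta_tuple n J) *
        (of_real (abs_vand (zeta_tuple n J) ^ 2) / schur (replicate d (n - d)) (zeta_tuple n J)))"

lemma expansion_coeff:
  assumes la: "la \<in> Sh d (n - d)" and mu: "mu \<in> Sh d (n - d)" and nu: "nu \<in> Sh d (n - d)"
    and exp: "is_expansion d n (s_elem d n la \<otimes>\<^bsub>Lambda_ring d n\<^esub> s_elem d n mu) N"
  shows "N k nu = (if (n - d) * d + k * n = sum_list la + sum_list mu + sum_list nu
                   then vafa_intriligator la mu nu else 0)"
proof -
  define c where "c = n - d"
  have n: "n > 0" using d_less by simp
  let ?base = "\<lambda>k. d - Suc k"
  let ?T = "\<lambda>x. case_prod N x"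
  define S where "S = {x. ?T x \<noteq> 0}"
  have fin: "finite S" and N_Sh: "\<And>k nu. nu \<notin> Sh d c \<Longrightarrow> N k nu = 0"
    and ideal: "s_poly d n la * s_poly d n mu -
      (\<Sum>x\<in>S. const (?T x) * (Q ^ fst x * s_poly d n (PD c (snd x)))) \<in> I"
  proof -
    have "s_elem d n la \<otimes>\<^bsub>Lambda_ring d n\<^esub> s_elem d n mu =
        Lambda_class d n (s_poly d n la * s_poly d n mu)"
      unfolding s_elem_def s_poly_def[symmetric] by (rule Lambda_class_mult) (rule s_poly_carrier)+
    with exp have "is_expansion d n (Lambda_class d n (s_poly d n la * s_poly d n mu)) N" by simp
    then show "finite S" "\<And>k nu. nu \<notin> Sh d c \<Longrightarrow> N k nu = 0"
      "s_poly d n la * s_poly d n mu -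
        (\<Sum>x\<in>S. const (?T x) * (Q ^ fst x * s_poly d n (PD c (snd x)))) \<in> I"
      by (auto simp: is_expansion_iff cpoly_carrier_mult s_poly_carrier S_def c_def case_prod_unfold)
  qed
  have S_Sh: "snd x \<in> Sh d c" if "x \<in> S" for x
    using that N_Sh by (auto simp: S_def case_prod_unfold)
  let ?xs = "\<lambda>A. map (shifted_root d n) A"
  have len: "length (?xs A) = d" if "A \<in> increasing_lists d n" for A
    using that by (simp add: increasing_lists_def)
  have eval: "t ^ (sum_list la + sum_list mu) * (schur la (?xs A) * schur mu (?xs A)) =
      (\<Sum>x\<in>S. ?T x * t ^ (n * fst x + sum_list (PD c (snd x))) * schur (PD c (snd x)) (?xs A))"
    if t: "t \<noteq> 0" and A: "A \<in> increasing_lists d n" for t A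
  proof -
    define xs where "xs = ?xs A"
    define ys where "ys = map ((*) t) xs"
    have xs: "length xs = d" "distinct xs"
      using len[OF A] distinct_map_shifted_root[OF A] by (simp_all add: xs_def)
    have ys: "length ys = d" "distinct ys"
      using xs t by (auto simp: ys_def distinct_map inj_on_def)
    have roots: "ys ! i ^ n = t ^ n * (- 1) ^ (d + 1)" if "i < d" for i
      using that len[OF A] n shifted_root_power[of n d "A ! i"]
      by (simp add: ys_def xs_def power_mult_distrib)
    have h: "complete_hom ys (int k) = (if k = n then t ^ n * (- 1) ^ (d + 1) else 0)"
      if "n < k + d" "k \<le> n" for k
      by (rule complete_hom_roots[OF ys(1) roots alternant_base_nonzero[OF ys] that])
    let ?ev = "poly_eval (\<lambda>i. elementary_sym ys (int i))"
    interpret ev: comm_ring_hom ?ev by (rule comm_ring_hom_poly_eval)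
    have "?ev Q = (- 1) ^ (d + 1) * complete_hom ys (int n)"
      by (simp add: Q_poly_def poly_eval_mult ev.hom_power ev.hom_uminus poly_eval_Y_poly[OF ys(1)])
    \<comment> \<open>At the scaled roots h_n = t^n (-1)^(d+1), and the sign in the definition of q
      cancels this one.\<close>
    also have "\<dots> = t ^ n * ((- 1) ^ (d + 1) * (- 1) ^ (d + 1))"
      using h[of n] d_pos by (simp only: mult_ac) simp
    finally have ev_Q: "?ev Q = t ^ n"
      by (simp flip: power_mult_distrib)
    have ev_s: "?ev (s_poly d n ka) = t ^ sum_list ka * schur ka xs" if "ka \<in> Sh d c" for ka
      using that xs t unfolding ys_def
      by (subst poly_eval_s_poly) (auto simp: c_def Sh_def schur_scale)
    have "?ev (Y_poly d k) = 0" if "n - d < k" "k < n" for k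
      using that h[of k] d_less by (simp add: poly_eval_Y_poly[OF ys(1)])
    from poly_eval_Lambda_ideal[OF this ideal]
    have "?ev (s_poly d n la * s_poly d n mu) =
        ?ev (\<Sum>x\<in>S. const (?T x) * (Q ^ fst x * s_poly d n (PD c (snd x))))"
      by (simp add: ev.hom_minus)
    also have "\<dots> = (\<Sum>x\<in>S. ?T x * ((t ^ n) ^ fst x * (t ^ sum_list (PD c (snd x)) * schur (PD c (snd x)) xs)))"
      using S_Sh PD_Sh
      by (simp add: poly_eval_sum poly_eval_mult poly_eval_const ev.hom_power ev_Q ev_s)
    finally show ?thesis
      using la mu by (simp add: ev.hom_mult ev_s c_def xs_def power_add power_mult mult_ac)
  qed
  define V where "V = vafa_intriligator la mu nu"
  \<comment> \<open>The degree of s_(PD nu); it is tied to |nu| only at the end, through m + |nu| =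
    c d, which avoids truncated subtraction.\<close>
  define m where "m = sum_list (PD c nu)"
  \<comment> \<open>|Vand|^2 is the base alternant times its conjugate, and S_nu / S_(c^d) is the
    conjugate of S_(PD nu). Together they form the conjugate alternant with which the product is
    paired.\<close>
  have V: "of_nat n ^ d * V = (\<Sum>A\<in>increasing_lists d n. schur la (?xs A) * schur mu (?xs A) *
      (alternant ?base (?xs A) * cnj (alternant (staircase d (PD c nu)) (?xs A))))"
  proof -
    have "of_nat n ^ d * V = (\<Sum>A\<in>increasing_lists d n. schur la (?xs A) * schur mu (?xs A) *
        schur nu (?xs A) * (of_real (abs_vand (?xs A) ^ 2) / schur (replicate d c) (?xs A)))"
      using n unfolding V_def vafa_intriligator_def
      by (subst sum.reindex_bij_betw[OF bij_betw_root_index[OF d_pos], symmetric])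
         (simp add: zeta_tuple_eq c_def)
    also have "\<dots> = (\<Sum>A\<in>increasing_lists d n. schur la (?xs A) * schur mu (?xs A) *
        (alternant ?base (?xs A) * cnj (alternant (staircase d (PD c nu)) (?xs A))))"
    proof (intro sum.cong refl)
      fix A assume A: "A \<in> increasing_lists d n"
      have "cnj (schur (PD c nu) (?xs A)) = schur nu (?xs A) / schur (replicate d c) (?xs A)"
        using nu len[OF A] distinct_map_shifted_root[OF A]
        by (intro cnj_schur_PD) (auto simp: c_def norm_shifted_root)
      moreover have "of_real (abs_vand (?xs A) ^ 2) = alternant ?base (?xs A) * cnj (alternant ?base (?xs A))"
        using cmod_alternant_base[OF len[OF A]] by (simp add: complex_norm_square[symmetric])
      moreover have "alternant (staircase d (PD c nu)) (?xs A) = schur (PD c nu) (?xs A) * alternant ?base (?xs A)"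
        using bialternant[OF len[OF A]] by simp
      ultimately show "schur la (?xs A) * schur mu (?xs A) *
        schur nu (?xs A) * (of_real (abs_vand (?xs A) ^ 2) / schur (replicate d c) (?xs A)) =
        schur la (?xs A) * schur mu (?xs A) *
        (alternant ?base (?xs A) * cnj (alternant (staircase d (PD c nu)) (?xs A)))"
        by (simp add: mult_ac)
    qed
    finally show ?thesis .
  qed
  \<comment> \<open>Pairing the evaluated expansion with the alternant of PD nu leaves only the
    terms indexed by nu, each with its own power of t.\<close>
  have main: "t ^ (sum_list la + sum_list mu) * V =
      (\<Sum>x\<in>S. if snd x = nu then ?T x * t ^ (n * fst x + m) else 0)" if t: "t \<noteq> 0" for t
  proof -
    let ?a = "\<lambda>ka A. alternant (staircase d (PD c ka)) (?xs A)"
    have "t ^ (sum_list la + sum_list mu) * (of_nat n ^ d * V) = (\<Sum>A\<in>increasing_lists d n.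
        (t ^ (sum_list la + sum_list mu) * (schur la (?xs A) * schur mu (?xs A))) *
        (alternant ?base (?xs A) * cnj (?a nu A)))"
      unfolding V by (simp add: sum_distrib_left mult_ac)
    also have "\<dots> = (\<Sum>A\<in>increasing_lists d n. \<Sum>x\<in>S.
        ?T x * t ^ (n * fst x + sum_list (PD c (snd x))) * (?a (snd x) A * cnj (?a nu A)))"
    proof (intro sum.cong refl)
      fix A assume A: "A \<in> increasing_lists d n"
      show "(t ^ (sum_list la + sum_list mu) * (schur la (?xs A) * schur mu (?xs A))) *
          (alternant ?base (?xs A) * cnj (?a nu A)) =
        (\<Sum>x\<in>S. ?T x * t ^ (n * fst x + sum_list (PD c (snd x))) * (?a (snd x) A * cnj (?a nu A)))"
        unfolding eval[OF t A] sum_distrib_right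
        by (intro sum.cong refl) (simp add: bialternant[OF len[OF A], symmetric] mult_ac)
    qed
    also have "\<dots> = (\<Sum>x\<in>S. ?T x * t ^ (n * fst x + sum_list (PD c (snd x))) *
        (\<Sum>A\<in>increasing_lists d n. ?a (snd x) A * cnj (?a nu A)))"
      by (subst sum.swap) (simp add: sum_distrib_left)
    also have "\<dots> = (\<Sum>x\<in>S. of_nat n ^ d * (if snd x = nu then ?T x * t ^ (n * fst x + m) else 0))"
    proof (intro sum.cong refl)
      fix x assume x: "x \<in> S"
      have PD: "PD c (snd x) \<in> Sh d (n - d)" "PD c nu \<in> Sh d (n - d)"
        using S_Sh[OF x] nu PD_Sh by (auto simp: c_def)
      have "(\<Sum>A\<in>increasing_lists d n. ?a (snd x) A * cnj (?a nu A)) =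
          (if \<forall>k<d. staircase d (PD c (snd x)) k = staircase d (PD c nu) k then of_nat n ^ d else 0)"
        using PD d_less
        by (intro alternants_orthogonal) (auto intro: staircase_decreasing staircase_less)
      also have "(\<forall>k<d. staircase d (PD c (snd x)) k = staircase d (PD c nu) k) \<longleftrightarrow> snd x = nu"
      proof
        assume "\<forall>k<d. staircase d (PD c (snd x)) k = staircase d (PD c nu) k"
        then have "PD c (snd x) = PD c nu" by (rule staircase_eqD[OF PD])
        then have "PD c (PD c (snd x)) = PD c (PD c nu)" by simp
        then show "snd x = nu"
          using PD_PD[OF S_Sh[OF x]] PD_PD[OF nu] by (simp add: c_def)
      qed simp
      finally show "?T x * t ^ (n * fst x + sum_list (PD c (snd x))) *
        (\<Sum>A\<in>increasing_lists d n. ?a (snd x) A * cnj (?a nu A)) =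
        of_nat n ^ d * (if snd x = nu then ?T x * t ^ (n * fst x + m) else 0)"
        by (auto simp: m_def)
    qed
    finally show ?thesis
      using n by (simp flip: sum_distrib_left)
  qed
  \<comment> \<open>The identity \<open>main\<close> holds for infinitely many t, hence
    coefficientwise.\<close>
  let ?p = "monom V (sum_list la + sum_list mu) - (\<Sum>x\<in>S. if snd x = nu then monom (?T x) (n * fst x + m) else 0)"
  have poly: "poly ?p t = 0" if "t \<noteq> 0" for t
    using main[OF that] by (simp add: poly_monom poly_sum if_distrib[of "\<lambda>p. poly p t"] mult_ac cong: if_cong)
  have "?p = 0"
  proof (rule ccontr)
    assume "?p \<noteq> 0"
    then have "finite {t. poly ?p t = 0}" by (rule poly_roots_finite)
    moreover have "{t. t \<noteq> 0} \<subseteq> {t. poly ?p t = 0}" using poly by blast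
    ultimately have "finite {t :: complex. t \<noteq> 0}" by (rule finite_subset[rotated])
    then have "finite (insert 0 {t :: complex. t \<noteq> 0})" by simp
    also have "insert 0 {t :: complex. t \<noteq> 0} = UNIV" by auto
    finally show False using infinite_UNIV_char_0[where 'a = complex] by simp
  qed
  then have "coeff (monom V (sum_list la + sum_list mu)) (n * k + m) =
      (\<Sum>x\<in>S. coeff (if snd x = nu then monom (?T x) (n * fst x + m) else 0) (n * k + m))"
    by (simp add: coeff_sum)
  \<comment> \<open>As n > 0, the degrees n k + m are distinct for distinct k, so a single
    coefficient survives.\<close>
  also have "\<dots> = (\<Sum>x\<in>S. if x = (k, nu) then N k nu else 0)"
    using n by (intro sum.cong refl) auto
  also have "\<dots> = N k nu"
    using fin by (auto simp: S_def)
  finally have "N k nu = (if sum_list la + sum_list mu = n * k + m then V else 0)"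
    by simp
  moreover have "m + sum_list nu = c * d"
    using nu unfolding m_def c_def by (rule sum_list_PD)
  then have "sum_list la + sum_list mu = n * k + m \<longleftrightarrow>
      c * d + k * n = sum_list la + sum_list mu + sum_list nu"
    by (auto simp: mult.commute)
  ultimately show ?thesis by (simp add: V_def c_def)
qed

lemma struct_const_eq:
  assumes "la \<in> Sh d (n - d)" "mu \<in> Sh d (n - d)" "nu \<in> Sh d (n - d)"
  shows "struct_const d n la mu nu k =
     (if (n - d) * d + k * n = sum_list la + sum_list mu + sum_list nu
      then vafa_intriligator la mu nu else 0)"
proof -
  let ?E = "is_expansion d n (s_elem d n la \<otimes>\<^bsub>Lambda_ring d n\<^esub> s_elem d n mu)"
  obtain N where N: "?E N" using is_expansion_exists[OF assms(2)] by blast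
  \<comment> \<open>Inside the box the formula fixes every coefficient; outside it both families
    vanish by the definition of an expansion.\<close>
  have unique: "N' = N" if "?E N'" for N'
  proof (intro ext)
    fix k nu
    show "N' k nu = N k nu"
    proof (cases "nu \<in> Sh d (n - d)")
      case True
      then show ?thesis using expansion_coeff[OF assms(1,2) True that] expansion_coeff[OF assms(1,2) True N] by simp
    next
      case False
      then show ?thesis using that N by (simp add: is_expansion_def)
    qed
  qed
  have "(THE N. ?E N) = N" by (rule the_equality) (fact N, fact unique)
  then show ?thesis
    using expansion_coeff[OF assms N] by (simp add: struct_const_def)
qed

end

theorem corollary6p2:
  fixes d n c k :: nat and la mu nu :: "nat list"
  assumes "2 \<le> n" and "1 \<le> d" and "d \<le> n - 1" and "c = n - d"
    and "la \<in> Sh d c" and "mu \<in> Sh d c" and "nu \<in> Sh d c"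
  shows "(c * d + k * n = sum_list la + sum_list mu + sum_list nu \<longrightarrow>
           struct_const d n la mu nu k =
             1 / of_nat n ^ d *
             (\<Sum>J\<in>root_index d n.
                schur la (zeta_tuple n J) * schur mu (zeta_tuple n J) *
                schur nu (zeta_tuple n J) *
                (of_real (abs_vand (zeta_tuple n J) ^ 2) /
                 schur (replicate d c) (zeta_tuple n J))))
       \<and> (c * d + k * n \<noteq> sum_list la + sum_list mu + sum_list nu \<longrightarrow>
           struct_const d n la mu nu k = 0)"
proof -
  interpret quantum d n
    by unfold_locales (use assms in auto)
  show ?thesis
    using assms struct_const_eq[of la mu nu k] unfolding vafa_intriligator_def by simp
qed

end
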